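(* Let $I$ be a non-empty set. Then the second dual Banach algebra $M_{I}(\mathbb{C})^{**}$ is strong pseudo-amenable if and only if $I$ is finite.
   Context: $M_I(\mathbb{C})$ is the Banach algebra of $I\times I$ complex matrices $(a_{i,j})$ with finite $\ell^1$-norm $\sum_{i,j}|a_{i,j}|<\infty$ and matrix multiplication. Its second dual is a Banach algebra with the (first) Arens product. Strong pseudo-amenability: for a (complex) Banach algebra $A$, $A\otimes_p A$ is the projective tensor product, a Banach $A$-bimodule via $a\cdot(b\otimes c)=ab\otimes c$, $(b\otimes c)\cdot a=b\otimes ca$; $\pi_A:A\otimes_pA\to A$ is the bounded linear map with $\pi_A(a\otimes b)=ab$. For a Banach $A$-bimodule $X$, $X^*$ is a Banach $A$-bimodule via $(a\cdot f)(x)=f(x\cdot a)$, $(f\cdot a)(x)=f(a\cdot x)$; iterating, $(A\otimes_pA)^{**}$ and $A^{**}$ are Banach $A$-bimodules, and $A\subseteq A^{**}$ canonically. $A$ is strong pseudo-amenable if there is a (not necessarily bounded) net $(m_\alpha)$ in $(A\otimes_pA)^{**}$ such that for every $a\in A$: $a\cdot m_\alpha-m_\alpha\cdot a\to 0$ in norm, $a\,\pi_A^{**}(m_\alpha)=\pi_A^{**}(m_\alpha)\,a$ for all $\alpha$, and $\pi_A^{**}(m_\alpha)\,a\to a$ in norm. *)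

theory Defs
  imports "HOL-Analysis.Analysis" "HOL-Library.Poly_Mapping"
begin

section \<open>Complex Banach spaces and algebras\<close>

class complex_banach = banach +
  fixes scaleC :: "complex \<Rightarrow> 'a \<Rightarrow> 'a"  (infixr \<open>*\<^sub>C\<close> 75)
  assumes scaleC_add_right: "c *\<^sub>C (x + y) = c *\<^sub>C x + c *\<^sub>C y"
    and scaleC_add_left: "(c + d) *\<^sub>C x = c *\<^sub>C x + d *\<^sub>C x"
    and scaleC_scaleC: "c *\<^sub>C d *\<^sub>C x = (c * d) *\<^sub>C x"
    and scaleR_scaleC: "r *\<^sub>R x = complex_of_real r *\<^sub>C x"
    and norm_scaleC: "norm (c *\<^sub>C x) = cmod c * norm x"

class complex_banach_algebra = complex_banach + real_normed_algebra +
  assumes mult_scaleC_left: "(c *\<^sub>C x) * y = c *\<^sub>C (x * y)"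
    and mult_scaleC_right: "x * (c *\<^sub>C y) = c *\<^sub>C (x * y)"

instantiation complex :: complex_banach_algebra
begin
definition scaleC_complex :: "complex \<Rightarrow> complex \<Rightarrow> complex"
  where "scaleC_complex c x = c * x"
instance
  by standard (simp_all add: scaleC_complex_def algebra_simps norm_mult scaleR_conv_of_real)
end

lemma scaleC_one [simp]: "1 *\<^sub>C x = (x :: 'a :: complex_banach)"
  using scaleR_scaleC[of 1 x] by simp

lemma scaleC_zero_right [simp]: "c *\<^sub>C (0 :: 'a :: complex_banach) = 0"
  using scaleC_add_right[of c 0 0] by simp

lemma scaleC_zero_left [simp]: "0 *\<^sub>C (x :: 'a :: complex_banach) = 0"
  using scaleC_add_left[of 0 0 x] by simp

lemma scaleC_minus_right: "c *\<^sub>C (- x) = - (c *\<^sub>C (x :: 'a :: complex_banach))"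
  using scaleC_add_right[of c x "- x"] by (simp add: eq_neg_iff_add_eq_0 add.commute)

lemma scaleC_diff_right: "c *\<^sub>C (x - y) = c *\<^sub>C x - c *\<^sub>C (y :: 'a :: complex_banach)"
  using scaleC_add_right[of c x "- y"] by (simp add: scaleC_minus_right)

lemma bounded_linear_scaleC: "bounded_linear (\<lambda>x :: 'a :: complex_banach. c *\<^sub>C x)"
  by (rule bounded_linear_intro[of _ "cmod c"])
    (simp_all add: scaleC_add_right scaleR_scaleC scaleC_scaleC norm_scaleC mult.commute)

definition bounded_clinear :: "('a::complex_banach \<Rightarrow> 'b::complex_banach) \<Rightarrow> bool"
  where "bounded_clinear f \<longleftrightarrow> bounded_linear f \<and> (\<forall>c x. f (c *\<^sub>C x) = c *\<^sub>C f x)"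

definition bounded_cbilinear ::
    "('a::complex_banach \<Rightarrow> 'b::complex_banach \<Rightarrow> 'c::complex_banach) \<Rightarrow> bool"
  where "bounded_cbilinear f \<longleftrightarrow> bounded_bilinear f \<and>
    (\<forall>c x y. f (c *\<^sub>C x) y = c *\<^sub>C f x y \<and> f x (c *\<^sub>C y) = c *\<^sub>C f x y)"

lemma bounded_clinearI:
  assumes "\<And>x y. f (x + y) = f x + f y" "\<And>c x. f (c *\<^sub>C x) = c *\<^sub>C f x"
    "\<And>x. norm (f x) \<le> norm x * K"
  shows "bounded_clinear f"
  unfolding bounded_clinear_def
  by (auto intro!: bounded_linear_intro[where K = K] simp: assms scaleR_scaleC)

lemma bounded_clinear_compose:
  "bounded_clinear f \<Longrightarrow> bounded_clinear g \<Longrightarrow> bounded_clinear (\<lambda>x. f (g x))"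
  unfolding bounded_clinear_def by (auto intro: bounded_linear_compose)

lemma bounded_clinear_eq_0: "bounded_clinear f \<Longrightarrow> f 0 = 0"
  by (simp add: bounded_clinear_def linear_simps)

lemma bounded_clinear_mult_left: "bounded_clinear (\<lambda>x :: 'a :: complex_banach_algebra. a * x)"
  by (rule bounded_clinearI[where K = "norm a"])
    (simp_all add: distrib_left mult_scaleC_right mult.commute[of _ "norm a"] norm_mult_ineq)

lemma bounded_clinear_mult_right: "bounded_clinear (\<lambda>x :: 'a :: complex_banach_algebra. x * a)"
  by (rule bounded_clinearI[where K = "norm a"])
    (simp_all add: distrib_right mult_scaleC_left norm_mult_ineq)

lemma bounded_cbilinear_mult:
  "bounded_cbilinear (\<lambda>x y :: 'a :: complex_banach_algebra. x * y)"
  by (simp add: bounded_cbilinear_def bounded_bilinear_mult mult_scaleC_left mult_scaleC_right)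


section \<open>Dual spaces\<close>

typedef (overloaded) 'a cdual = "{f :: 'a::complex_banach \<Rightarrow> complex. bounded_clinear f}"
  morphisms cdual_apply Cdual
  by (rule exI[of _ "\<lambda>_. 0"]) (auto intro: bounded_clinearI[where K = 0])

setup_lifting type_definition_cdual

lemma cdual_eqI: "(\<And>x. cdual_apply f x = cdual_apply g x) \<Longrightarrow> f = g"
  by transfer auto

lemma bounded_clinear_cdual_apply: "bounded_clinear (cdual_apply f)"
  using cdual_apply[of f] by simp

lemma cdual_apply_Cdual: "bounded_clinear f \<Longrightarrow> cdual_apply (Cdual f) = f"
  by (simp add: Cdual_inverse)

instantiation cdual :: (complex_banach) real_normed_vector
begin

lift_definition norm_cdual :: "'a cdual \<Rightarrow> real" is onorm .

lift_definition minus_cdual :: "'a cdual \<Rightarrow> 'a cdual \<Rightarrow> 'a cdual" is "\<lambda>f g x. f x - g x"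
  by (auto simp: bounded_clinear_def scaleC_diff_right intro: bounded_linear_sub)

lift_definition uminus_cdual :: "'a cdual \<Rightarrow> 'a cdual" is "\<lambda>f x. - f x"
  by (auto simp: bounded_clinear_def scaleC_minus_right intro: bounded_linear_minus)

lift_definition zero_cdual :: "'a cdual" is "\<lambda>_. 0"
  by (auto intro: bounded_clinearI[where K = 0])

lift_definition plus_cdual :: "'a cdual \<Rightarrow> 'a cdual \<Rightarrow> 'a cdual" is "\<lambda>f g x. f x + g x"
  by (auto simp: bounded_clinear_def scaleC_add_right intro: bounded_linear_add)

lift_definition scaleR_cdual :: "real \<Rightarrow> 'a cdual \<Rightarrow> 'a cdual" is "\<lambda>r f x. r *\<^sub>R f x"
  by (auto simp: bounded_clinear_def scaleR_scaleC scaleC_scaleC mult.commute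
      intro: bounded_linear_compose[OF bounded_linear_scaleC])

definition dist_cdual :: "'a cdual \<Rightarrow> 'a cdual \<Rightarrow> real"
  where "dist_cdual a b = norm (a - b)"

definition [code del]:
  "(uniformity :: ('a cdual \<times> 'a cdual) filter) = (INF e\<in>{0 <..}. principal {(x, y). dist x y < e})"

definition open_cdual :: "'a cdual set \<Rightarrow> bool"
  where [code del]: "open_cdual S = (\<forall>x\<in>S. \<forall>\<^sub>F (x', y) in uniformity. x' = x \<longrightarrow> y \<in> S)"

definition sgn_cdual :: "'a cdual \<Rightarrow> 'a cdual"
  where "sgn_cdual x = scaleR (inverse (norm x)) x"

instance
  apply standard
  unfolding dist_cdual_def open_cdual_def sgn_cdual_def uniformity_cdual_def
  apply (rule refl | (transfer, force simp: onorm_triangle onorm_scaleR onorm_eq_0 algebra_simps bounded_clinear_def))+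
  done

end

lemma cdual_apply_simps [simp]:
  "cdual_apply (f + g) x = cdual_apply f x + cdual_apply g x"
  "cdual_apply (f - g) x = cdual_apply f x - cdual_apply g x"
  "cdual_apply (- f) x = - cdual_apply f x"
  "cdual_apply 0 x = 0"
  "cdual_apply (r *\<^sub>R f) x = r *\<^sub>R cdual_apply f x"
  by (transfer; simp)+

lemma cdual_apply_add_right: "cdual_apply f (x + y) = cdual_apply f x + cdual_apply f y"
  using bounded_clinear_cdual_apply[of f] by (simp add: bounded_clinear_def linear_simps)

lemma cdual_apply_scaleC_right: "cdual_apply f (c *\<^sub>C x) = c * cdual_apply f x"
  using bounded_clinear_cdual_apply[of f] by (simp add: bounded_clinear_def scaleC_complex_def)

lemma norm_cdual_apply: "cmod (cdual_apply f x) \<le> norm f * norm x"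
  by transfer (simp add: bounded_clinear_def onorm)

lemma norm_cdual_bound: "0 \<le> b \<Longrightarrow> (\<And>x. cmod (cdual_apply f x) \<le> b * norm x) \<Longrightarrow> norm f \<le> b"
  by transfer (rule onorm_bound)

instantiation cdual :: (complex_banach) complex_banach
begin

lift_definition scaleC_cdual :: "complex \<Rightarrow> 'a cdual \<Rightarrow> 'a cdual" is "\<lambda>c f x. c * f x"
  by (auto simp: bounded_clinear_def scaleC_complex_def intro: bounded_linear_const_mult)

instance
proof
  fix X :: "nat \<Rightarrow> 'a cdual"
  assume X: "Cauchy X"
  define Y where "Y n = Blinfun (cdual_apply (X n))" for n
  have bl: "bounded_linear (cdual_apply f)" for f :: "'a cdual"
    using bounded_clinear_cdual_apply[of f] by (simp add: bounded_clinear_def)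
  have Y: "blinfun_apply (Y n) x = cdual_apply (X n) x" for n x
    by (simp add: Y_def bounded_linear_Blinfun_apply bl)
  have "norm (Y m - Y n) = norm (X m - X n)" for m n
    by (simp add: norm_blinfun.rep_eq norm_cdual.rep_eq minus_blinfun.rep_eq
        minus_cdual.rep_eq Y)
  with X have "Cauchy Y" by (simp add: Cauchy_iff)
  then obtain L where L: "Y \<longlonglongrightarrow> L" by (auto simp: Cauchy_convergent_iff convergent_def)
  have lim: "(\<lambda>n. cdual_apply (X n) x) \<longlonglongrightarrow> blinfun_apply L x" for x
    using bounded_linear.tendsto[OF blinfun.bounded_linear_left[of x] L] by (simp add: Y)
  have "blinfun_apply L (c *\<^sub>C x) = c * blinfun_apply L x" for c x
    using lim[of "c *\<^sub>C x"] tendsto_mult[OF tendsto_const[of c] lim[of x]]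
    by (simp add: cdual_apply_scaleC_right LIMSEQ_unique)
  then have bc: "bounded_clinear (blinfun_apply L)"
    by (simp add: bounded_clinear_def scaleC_complex_def blinfun.bounded_linear_right)
  have "norm (X n - Cdual (blinfun_apply L)) = norm (Y n - L)" for n
    by (simp add: norm_blinfun.rep_eq norm_cdual.rep_eq minus_blinfun.rep_eq
        minus_cdual.rep_eq Y cdual_apply_Cdual bc)
  then have "X \<longlonglongrightarrow> Cdual (blinfun_apply L)"
    using L by (simp add: LIMSEQ_iff)
  then show "convergent X" by (auto simp: convergent_def)
next
  fix c :: complex and f :: "'a cdual"
  show "norm (c *\<^sub>C f) = cmod c * norm f"
  proof (cases "c = 0")
    case True
    then show ?thesis by transfer (simp add: onorm_zero)
  next
    case False
    have le: "norm (d *\<^sub>C g) \<le> cmod d * norm g" for d and g :: "'a cdual"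
      by (rule norm_cdual_bound)
        (auto simp: scaleC_cdual.rep_eq norm_mult mult.assoc intro!: mult_left_mono norm_cdual_apply)
    have "f = inverse c *\<^sub>C c *\<^sub>C f"
      using False by transfer auto
    with le[of "inverse c" "c *\<^sub>C f"] have "norm f \<le> inverse (cmod c) * norm (c *\<^sub>C f)"
      by (simp add: norm_inverse)
    then have "cmod c * norm f \<le> norm (c *\<^sub>C f)"
      using False by (simp add: field_simps)
    with le[of c f] show ?thesis by simp
  qed
qed (transfer; simp add: algebra_simps scaleR_conv_of_real)+

end

lemma cdual_apply_scaleC [simp]: "cdual_apply (c *\<^sub>C f) x = c * cdual_apply f x"
  by transfer simp

definition dual_map :: "('a::complex_banach \<Rightarrow> 'b::complex_banach) \<Rightarrow> 'b cdual \<Rightarrow> 'a cdual"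
  where "dual_map T f = Cdual (\<lambda>x. cdual_apply f (T x))"

lemma dual_map_apply: "bounded_clinear T \<Longrightarrow> cdual_apply (dual_map T f) x = cdual_apply f (T x)"
  unfolding dual_map_def
  by (simp add: cdual_apply_Cdual bounded_clinear_compose bounded_clinear_cdual_apply)

lemma bounded_clinear_dual_map:
  assumes T: "bounded_clinear T"
  shows "bounded_clinear (dual_map T)"
proof -
  have "bounded_linear T" using T by (simp add: bounded_clinear_def)
  then obtain K where K: "0 \<le> K" "\<And>x. norm (T x) \<le> norm x * K"
    using bounded_linear.nonneg_bounded by blast
  show ?thesis
  proof (rule bounded_clinearI[where K = K])
    fix f :: "'b cdual"
    show "norm (dual_map T f) \<le> norm f * K"
    proof (rule norm_cdual_bound)
      fix x
      have "cmod (cdual_apply f (T x)) \<le> norm f * norm (T x)" by (rule norm_cdual_apply)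
      also have "\<dots> \<le> norm f * (norm x * K)" by (intro mult_left_mono K) auto
      finally show "cmod (cdual_apply (dual_map T f) x) \<le> norm f * K * norm x"
        by (simp add: dual_map_apply T mult_ac)
    qed (use K in auto)
  qed (auto intro!: cdual_eqI simp: dual_map_apply T)
qed

lift_definition canonical_embedding :: "'a::complex_banach \<Rightarrow> 'a cdual cdual"
  is "\<lambda>x f. cdual_apply f x"
proof -
  fix x :: 'a
  show "bounded_clinear (\<lambda>f. cdual_apply f x)"
    by (rule bounded_clinearI[where K = "norm x"])
      (auto simp: scaleC_complex_def norm_cdual_apply)
qed

text \<open>
  For a Banach bimodule with left action \<open>L\<close> and right action \<open>R\<close>, the dual actions are
  \<open>(a \<cdot> f) x = f (x \<cdot> a)\<close> and \<open>(f \<cdot> a) x = f (a \<cdot> x)\<close>.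
\<close>

definition dual_left :: "('x::complex_banach \<Rightarrow> 'a \<Rightarrow> 'x) \<Rightarrow> 'a \<Rightarrow> 'x cdual \<Rightarrow> 'x cdual"
  where "dual_left R a = dual_map (\<lambda>x. R x a)"

definition dual_right :: "('a \<Rightarrow> 'x::complex_banach \<Rightarrow> 'x) \<Rightarrow> 'x cdual \<Rightarrow> 'a \<Rightarrow> 'x cdual"
  where "dual_right L f a = dual_map (\<lambda>x. L a x) f"

abbreviation bidual_left ::
    "('a \<Rightarrow> 'x::complex_banach \<Rightarrow> 'x) \<Rightarrow> 'a \<Rightarrow> 'x cdual cdual \<Rightarrow> 'x cdual cdual"
  where "bidual_left L \<equiv> dual_left (dual_right L)"

abbreviation bidual_right ::
    "('x::complex_banach \<Rightarrow> 'a \<Rightarrow> 'x) \<Rightarrow> 'x cdual cdual \<Rightarrow> 'a \<Rightarrow> 'x cdual cdual"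
  where "bidual_right R \<equiv> dual_right (dual_left R)"


section \<open>The second dual with the first Arens product\<close>

typedef (overloaded) 'a bidual = "UNIV :: 'a::complex_banach cdual cdual set"
  morphisms bidual_functional Bidual ..

setup_lifting type_definition_bidual

instantiation bidual :: (complex_banach) real_normed_vector
begin

lift_definition norm_bidual :: "'a bidual \<Rightarrow> real" is norm .
lift_definition minus_bidual :: "'a bidual \<Rightarrow> 'a bidual \<Rightarrow> 'a bidual" is minus .
lift_definition uminus_bidual :: "'a bidual \<Rightarrow> 'a bidual" is uminus .
lift_definition zero_bidual :: "'a bidual" is 0 .
lift_definition plus_bidual :: "'a bidual \<Rightarrow> 'a bidual \<Rightarrow> 'a bidual" is plus .
lift_definition scaleR_bidual :: "real \<Rightarrow> 'a bidual \<Rightarrow> 'a bidual" is scaleR .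

definition dist_bidual :: "'a bidual \<Rightarrow> 'a bidual \<Rightarrow> real"
  where "dist_bidual a b = norm (a - b)"

definition [code del]:
  "(uniformity :: ('a bidual \<times> 'a bidual) filter) = (INF e\<in>{0 <..}. principal {(x, y). dist x y < e})"

definition open_bidual :: "'a bidual set \<Rightarrow> bool"
  where [code del]: "open_bidual S = (\<forall>x\<in>S. \<forall>\<^sub>F (x', y) in uniformity. x' = x \<longrightarrow> y \<in> S)"

definition sgn_bidual :: "'a bidual \<Rightarrow> 'a bidual"
  where "sgn_bidual x = scaleR (inverse (norm x)) x"

instance
  apply standard
  unfolding dist_bidual_def open_bidual_def sgn_bidual_def uniformity_bidual_def
  apply (rule refl | (transfer, simp add: algebra_simps norm_triangle_ineq))+
  done

end

instantiation bidual :: (complex_banach) complex_banach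
begin

lift_definition scaleC_bidual :: "complex \<Rightarrow> 'a bidual \<Rightarrow> 'a bidual" is scaleC .

instance
proof
  fix X :: "nat \<Rightarrow> 'a bidual"
  assume "Cauchy X"
  then have "Cauchy (\<lambda>n. bidual_functional (X n))"
    by (simp add: Cauchy_iff norm_bidual.rep_eq minus_bidual.rep_eq)
  then obtain L where "(\<lambda>n. bidual_functional (X n)) \<longlonglongrightarrow> L"
    by (auto simp: Cauchy_convergent_iff convergent_def)
  then have "X \<longlonglongrightarrow> Bidual L"
    by (simp add: LIMSEQ_iff norm_bidual.rep_eq minus_bidual.rep_eq Bidual_inverse)
  then show "convergent X" by (auto simp: convergent_def)
qed (transfer; simp add: scaleC_add_right scaleC_add_left scaleC_scaleC scaleR_scaleC norm_scaleC)+

end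

text \<open>
  With \<open>(f \<cdot> a) b = f (a b)\<close> and \<open>(G \<cdot> f) a = G (f \<cdot> a)\<close>, the first Arens product is
  \<open>(F \<box> G) f = F (G \<cdot> f)\<close>.
\<close>

definition arens_act :: "'a::complex_banach_algebra cdual cdual \<Rightarrow> 'a cdual \<Rightarrow> 'a cdual"
  where "arens_act G f = Cdual (\<lambda>a. cdual_apply G (dual_right (*) f a))"

definition first_arens ::
    "'a::complex_banach_algebra cdual cdual \<Rightarrow> 'a cdual cdual \<Rightarrow> 'a cdual cdual"
  where "first_arens F G = Cdual (\<lambda>f. cdual_apply F (arens_act G f))"

lemma dual_right_mult_apply [simp]:
  "cdual_apply (dual_right (*) f a) b = cdual_apply f (a * b)" for a :: "'a::complex_banach_algebra"
  by (simp add: dual_right_def dual_map_apply bounded_clinear_mult_left)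

lemma norm_dual_right_mult:
  "norm (dual_right (*) f a) \<le> norm f * norm a" for a :: "'a::complex_banach_algebra"
proof (rule norm_cdual_bound)
  fix x
  have "cmod (cdual_apply f (a * x)) \<le> norm f * norm (a * x)" by (rule norm_cdual_apply)
  also have "\<dots> \<le> norm f * (norm a * norm x)" by (intro mult_left_mono norm_mult_ineq) auto
  finally show "cmod (cdual_apply (dual_right (*) f a) x) \<le> norm f * norm a * norm x"
    by (simp add: mult_ac)
qed auto

lemma bounded_clinear_arens_act_aux:
  "bounded_clinear (\<lambda>a :: 'a::complex_banach_algebra. cdual_apply G (dual_right (*) f a))"
proof (rule bounded_clinearI[where K = "norm G * norm f"])
  fix a b :: 'a and c
  have "dual_right (*) f (a + b) = dual_right (*) f a + dual_right (*) f b"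
    by (rule cdual_eqI) (simp add: cdual_apply_add_right distrib_right)
  then show "cdual_apply G (dual_right (*) f (a + b))
      = cdual_apply G (dual_right (*) f a) + cdual_apply G (dual_right (*) f b)"
    by (simp add: cdual_apply_add_right)
  have "dual_right (*) f (c *\<^sub>C a) = c *\<^sub>C dual_right (*) f a"
    by (rule cdual_eqI) (simp add: cdual_apply_scaleC_right mult_scaleC_left)
  then show "cdual_apply G (dual_right (*) f (c *\<^sub>C a)) = c *\<^sub>C cdual_apply G (dual_right (*) f a)"
    by (simp add: cdual_apply_scaleC_right scaleC_complex_def)
  have "cmod (cdual_apply G (dual_right (*) f a)) \<le> norm G * norm (dual_right (*) f a)"
    by (rule norm_cdual_apply)
  also have "\<dots> \<le> norm G * (norm f * norm a)"
    by (intro mult_left_mono norm_dual_right_mult) auto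
  finally show "cmod (cdual_apply G (dual_right (*) f a)) \<le> norm a * (norm G * norm f)"
    by (simp add: mult_ac)
qed

lemma arens_act_apply:
  "cdual_apply (arens_act G f) a = cdual_apply G (dual_right (*) f a)"
  by (simp add: arens_act_def cdual_apply_Cdual bounded_clinear_arens_act_aux)

lemma norm_arens_act: "norm (arens_act G f) \<le> norm G * norm f"
proof (rule norm_cdual_bound)
  fix a
  have "cmod (cdual_apply G (dual_right (*) f a)) \<le> norm G * norm (dual_right (*) f a)"
    by (rule norm_cdual_apply)
  also have "\<dots> \<le> norm G * (norm f * norm a)"
    by (intro mult_left_mono norm_dual_right_mult) auto
  finally show "cmod (cdual_apply (arens_act G f) a) \<le> norm G * norm f * norm a"
    by (simp add: arens_act_apply mult_ac)
qed auto

lemma arens_act_linear: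
  "arens_act G (f + g) = arens_act G f + arens_act G g"
  "arens_act G (c *\<^sub>C f) = c *\<^sub>C arens_act G f"
  "arens_act (G + H) f = arens_act G f + arens_act H f"
  "arens_act (c *\<^sub>C G) f = c *\<^sub>C arens_act G f"
proof -
  have 1: "dual_right (*) (f + g) a = dual_right (*) f a + dual_right (*) g a" for a
    by (rule cdual_eqI) simp
  have 2: "dual_right (*) (c *\<^sub>C f) a = c *\<^sub>C dual_right (*) f a" for a
    by (rule cdual_eqI) simp
  show "arens_act G (f + g) = arens_act G f + arens_act G g"
    "arens_act G (c *\<^sub>C f) = c *\<^sub>C arens_act G f"
    "arens_act (G + H) f = arens_act G f + arens_act H f"
    "arens_act (c *\<^sub>C G) f = c *\<^sub>C arens_act G f"
    by (rule cdual_eqI, simp add: arens_act_apply 1 2 cdual_apply_add_right cdual_apply_scaleC_right)+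
qed

lemma norm_first_arens_aux:
  "cmod (cdual_apply F (arens_act G f)) \<le> norm F * norm G * norm f"
proof -
  have "cmod (cdual_apply F (arens_act G f)) \<le> norm F * norm (arens_act G f)"
    by (rule norm_cdual_apply)
  also have "\<dots> \<le> norm F * (norm G * norm f)"
    by (intro mult_left_mono norm_arens_act) auto
  finally show ?thesis by (simp add: mult_ac)
qed

lemma first_arens_apply:
  "cdual_apply (first_arens F G) f = cdual_apply F (arens_act G f)"
proof -
  have "bounded_clinear (\<lambda>f. cdual_apply F (arens_act G f))"
  proof (rule bounded_clinearI[where K = "norm F * norm G"])
    show "cmod (cdual_apply F (arens_act G f)) \<le> norm f * (norm F * norm G)" for f
      using norm_first_arens_aux[of F G f] by (metis mult.commute)
  qed (simp_all add: arens_act_linear cdual_apply_add_right cdual_apply_scaleC_right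
      scaleC_complex_def)
  then show ?thesis by (simp add: first_arens_def cdual_apply_Cdual)
qed

lemma first_arens_assoc: "first_arens (first_arens F G) H = first_arens F (first_arens G H)"
proof -
  have 1: "dual_right (*) (dual_right (*) f a) b = dual_right (*) f (a * b)"
    for f :: "'a cdual" and a b
    by (rule cdual_eqI) (simp add: mult.assoc)
  have 2: "dual_right (*) (arens_act H f) a = arens_act H (dual_right (*) f a)" for f a
    by (rule cdual_eqI) (simp add: arens_act_apply 1)
  have "arens_act (first_arens G H) f = arens_act G (arens_act H f)" for f
    by (rule cdual_eqI) (simp add: arens_act_apply first_arens_apply 2)
  then show ?thesis by (intro cdual_eqI) (simp add: first_arens_apply)
qed

instantiation bidual :: (complex_banach_algebra) complex_banach_algebra
begin

lift_definition times_bidual :: "'a bidual \<Rightarrow> 'a bidual \<Rightarrow> 'a bidual" is first_arens .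

instance
proof
  fix F G H :: "'a bidual" and c :: complex and r :: real
  show "F * G * H = F * (G * H)" by transfer (rule first_arens_assoc)
  show "(F + G) * H = F * H + G * H"
    by transfer (auto intro!: cdual_eqI simp: first_arens_apply)
  show "F * (G + H) = F * G + F * H"
    by transfer
      (auto intro!: cdual_eqI simp: first_arens_apply arens_act_linear cdual_apply_add_right)
  show C1: "(c *\<^sub>C F) * G = c *\<^sub>C (F * G)" for c
    by transfer (auto intro!: cdual_eqI simp: first_arens_apply)
  show C2: "F * (c *\<^sub>C G) = c *\<^sub>C (F * G)" for c
    by transfer
      (auto intro!: cdual_eqI simp: first_arens_apply arens_act_linear cdual_apply_scaleC_right)
  show "(r *\<^sub>R F) * G = r *\<^sub>R (F * G)" "F * (r *\<^sub>R G) = r *\<^sub>R (F * G)"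
    by (simp_all add: scaleR_scaleC C1 C2)
  show "norm (F * G) \<le> norm F * norm G"
    by transfer (auto intro!: norm_cdual_bound norm_first_arens_aux simp: first_arens_apply)
qed

end


section \<open>The algebra of \<open>\<ell>\<^sup>1\<close> matrices\<close>

typedef 'i l1_matrix =
  "{a :: 'i \<Rightarrow> 'i \<Rightarrow> complex. (\<lambda>(i, j). cmod (a i j)) summable_on UNIV}"
  morphisms entry L1_matrix
  by (rule exI[of _ "\<lambda>_ _. 0"]) (auto simp: case_prod_unfold)

setup_lifting type_definition_l1_matrix

lemma l1_matrix_eqI: "(\<And>i j. entry a i j = entry b i j) \<Longrightarrow> a = b"
  by transfer auto

lemma l1_matrix_bounded:
  fixes a :: "'i \<Rightarrow> 'i \<Rightarrow> complex"
  assumes "\<And>F. finite F \<Longrightarrow> (\<Sum>(i, j)\<in>F. cmod (a i j)) \<le> K"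
  shows "(\<lambda>(i, j). cmod (a i j)) summable_on UNIV" "(\<Sum>\<^sub>\<infinity>(i, j). cmod (a i j)) \<le> K"
proof -
  show *: "(\<lambda>(i, j). cmod (a i j)) summable_on UNIV"
    by (rule nonneg_bdd_above_summable_on) (auto intro!: bdd_aboveI2[where M = K] assms)
  show "(\<Sum>\<^sub>\<infinity>(i, j). cmod (a i j)) \<le> K"
    by (rule infsum_le_finite_sums[OF *]) (rule assms)
qed

lemma l1_matrix_summable_linear:
  fixes a b :: "'i \<Rightarrow> 'i \<Rightarrow> complex"
  assumes a: "(\<lambda>(i, j). cmod (a i j)) summable_on UNIV"
    and b: "(\<lambda>(i, j). cmod (b i j)) summable_on UNIV"
  shows "(\<lambda>(i, j). cmod (a i j + b i j)) summable_on UNIV"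
    "(\<Sum>\<^sub>\<infinity>(i, j). cmod (a i j + b i j)) \<le> (\<Sum>\<^sub>\<infinity>(i, j). cmod (a i j)) + (\<Sum>\<^sub>\<infinity>(i, j). cmod (b i j))"
proof -
  have "(\<Sum>(i, j)\<in>F. cmod (a i j + b i j))
      \<le> (\<Sum>\<^sub>\<infinity>(i, j). cmod (a i j)) + (\<Sum>\<^sub>\<infinity>(i, j). cmod (b i j))" if "finite F" for F
  proof -
    have "(\<Sum>(i, j)\<in>F. cmod (a i j + b i j)) \<le> (\<Sum>p\<in>F. (\<lambda>(i, j). cmod (a i j)) p + (\<lambda>(i, j). cmod (b i j)) p)"
      by (rule sum_mono) (auto intro: norm_triangle_ineq)
    also have "\<dots> = (\<Sum>(i, j)\<in>F. cmod (a i j)) + (\<Sum>(i, j)\<in>F. cmod (b i j))"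
      by (rule sum.distrib)
    also have "\<dots> \<le> (\<Sum>\<^sub>\<infinity>(i, j). cmod (a i j)) + (\<Sum>\<^sub>\<infinity>(i, j). cmod (b i j))"
      by (intro add_mono finite_sum_le_infsum a b that) auto
    finally show ?thesis .
  qed
  from l1_matrix_bounded[of "\<lambda>i j. a i j + b i j", OF this] show
    "(\<lambda>(i, j). cmod (a i j + b i j)) summable_on UNIV"
    "(\<Sum>\<^sub>\<infinity>(i, j). cmod (a i j + b i j)) \<le> (\<Sum>\<^sub>\<infinity>(i, j). cmod (a i j)) + (\<Sum>\<^sub>\<infinity>(i, j). cmod (b i j))"
    by auto
qed

lemma l1_matrix_summable_scale:
  fixes a :: "'i \<Rightarrow> 'i \<Rightarrow> complex"
  assumes a: "(\<lambda>(i, j). cmod (a i j)) summable_on UNIV"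
  shows "(\<lambda>(i, j). cmod (c * a i j)) summable_on UNIV"
    "(\<Sum>\<^sub>\<infinity>(i, j). cmod (c * a i j)) = cmod c * (\<Sum>\<^sub>\<infinity>(i, j). cmod (a i j))"
proof -
  have eq: "(\<lambda>(i, j). cmod (c * a i j)) = (\<lambda>p. cmod c * (\<lambda>(i, j). cmod (a i j)) p)"
    by (auto simp: norm_mult)
  show "(\<lambda>(i, j). cmod (c * a i j)) summable_on UNIV"
    unfolding eq by (rule summable_on_cmult_right[OF a])
  show "(\<Sum>\<^sub>\<infinity>(i, j). cmod (c * a i j)) = cmod c * (\<Sum>\<^sub>\<infinity>(i, j). cmod (a i j))"
    unfolding eq by (rule infsum_cmult_right) (rule a)
qed

lemma l1_matrix_summable_minus:
  fixes a :: "'i \<Rightarrow> 'i \<Rightarrow> complex"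
  assumes "(\<lambda>(i, j). cmod (a i j)) summable_on UNIV" "(\<lambda>(i, j). cmod (b i j)) summable_on UNIV"
  shows "(\<lambda>(i, j). cmod (a i j - b i j)) summable_on UNIV"
  using l1_matrix_summable_linear(1)[OF assms(1) l1_matrix_summable_scale(1)[OF assms(2), of "-1"]]
  by simp

lemma l1_matrix_entry_le:
  fixes a :: "'i \<Rightarrow> 'i \<Rightarrow> complex"
  assumes "(\<lambda>(i, j). cmod (a i j)) summable_on UNIV"
  shows "cmod (a i j) \<le> (\<Sum>\<^sub>\<infinity>(i, j). cmod (a i j))"
  using finite_sum_le_infsum[OF assms, of "{(i, j)}"] by auto

instantiation l1_matrix :: (type) real_normed_vector
begin

lift_definition norm_l1_matrix :: "'a l1_matrix \<Rightarrow> real" is "\<lambda>a. \<Sum>\<^sub>\<infinity>(i, j). cmod (a i j)" .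

lift_definition minus_l1_matrix :: "'a l1_matrix \<Rightarrow> 'a l1_matrix \<Rightarrow> 'a l1_matrix"
  is "\<lambda>a b i j. a i j - b i j"
  by (rule l1_matrix_summable_minus)

lift_definition uminus_l1_matrix :: "'a l1_matrix \<Rightarrow> 'a l1_matrix" is "\<lambda>a i j. - a i j"
  by simp

lift_definition zero_l1_matrix :: "'a l1_matrix" is "\<lambda>_ _. 0"
  by (simp add: case_prod_unfold)

lift_definition plus_l1_matrix :: "'a l1_matrix \<Rightarrow> 'a l1_matrix \<Rightarrow> 'a l1_matrix"
  is "\<lambda>a b i j. a i j + b i j"
  by (rule l1_matrix_summable_linear)

lift_definition scaleR_l1_matrix :: "real \<Rightarrow> 'a l1_matrix \<Rightarrow> 'a l1_matrix"
  is "\<lambda>r a i j. complex_of_real r * a i j"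
  by (rule l1_matrix_summable_scale)

definition dist_l1_matrix :: "'a l1_matrix \<Rightarrow> 'a l1_matrix \<Rightarrow> real"
  where "dist_l1_matrix a b = norm (a - b)"

definition [code del]:
  "(uniformity :: ('a l1_matrix \<times> 'a l1_matrix) filter)
    = (INF e\<in>{0 <..}. principal {(x, y). dist x y < e})"

definition open_l1_matrix :: "'a l1_matrix set \<Rightarrow> bool"
  where [code del]: "open_l1_matrix S = (\<forall>x\<in>S. \<forall>\<^sub>F (x', y) in uniformity. x' = x \<longrightarrow> y \<in> S)"

definition sgn_l1_matrix :: "'a l1_matrix \<Rightarrow> 'a l1_matrix"
  where "sgn_l1_matrix x = scaleR (inverse (norm x)) x"

instance
proof
  fix a b :: "'a l1_matrix" and r :: real
  show "(norm a = 0) = (a = 0)"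
  proof
    show "norm a = 0 \<Longrightarrow> a = 0"
    proof transfer
      fix a :: "'a \<Rightarrow> 'a \<Rightarrow> complex"
      assume "(\<lambda>(i, j). cmod (a i j)) summable_on UNIV" "(\<Sum>\<^sub>\<infinity>(i, j). cmod (a i j)) = 0"
      then show "a = (\<lambda>_ _. 0)"
        using l1_matrix_entry_le[of a] by (intro ext) auto
    qed
  qed (transfer, simp add: case_prod_unfold)
  show "norm (a + b) \<le> norm a + norm b"
    by transfer (rule l1_matrix_summable_linear)
  show "norm (r *\<^sub>R a) = \<bar>r\<bar> * norm a"
    by transfer (simp only: l1_matrix_summable_scale norm_of_real)
qed (unfold dist_l1_matrix_def open_l1_matrix_def sgn_l1_matrix_def uniformity_l1_matrix_def,
    (rule refl | (transfer, simp add: algebra_simps))+)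

end

lemma entry_summable: "(\<lambda>(i, j). cmod (entry a i j)) summable_on UNIV"
  using entry[of a] by simp

lemma norm_entry_le: "cmod (entry a i j) \<le> norm a"
  unfolding norm_l1_matrix.rep_eq by (rule l1_matrix_entry_le) (rule entry_summable)

instantiation l1_matrix :: (type) complex_banach
begin

lift_definition scaleC_l1_matrix :: "complex \<Rightarrow> 'a l1_matrix \<Rightarrow> 'a l1_matrix"
  is "\<lambda>c a i j. c * a i j"
  by (rule l1_matrix_summable_scale)

instance
proof
  fix X :: "nat \<Rightarrow> 'a l1_matrix"
  assume X: "Cauchy X"
  have "Cauchy (\<lambda>n. entry (X n) i j)" for i j
  proof (rule CauchyI)
    fix e :: real
    assume "0 < e"
    with X obtain M where M: "\<And>m n. m \<ge> M \<Longrightarrow> n \<ge> M \<Longrightarrow> norm (X m - X n) < e"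
      using CauchyD by blast
    show "\<exists>M. \<forall>m\<ge>M. \<forall>n\<ge>M. cmod (entry (X m) i j - entry (X n) i j) < e"
    proof (intro exI allI impI)
      fix m n assume "M \<le> m" "M \<le> n"
      with norm_entry_le[of "X m - X n" i j] M[of m n]
      show "cmod (entry (X m) i j - entry (X n) i j) < e"
        by (simp add: minus_l1_matrix.rep_eq)
    qed
  qed
  then obtain L where L: "\<And>i j. (\<lambda>n. entry (X n) i j) \<longlonglongrightarrow> L i j"
    unfolding Cauchy_convergent_iff convergent_def by metis
  have close: "(\<Sum>(i, j)\<in>F. cmod (L i j - entry (X n) i j)) \<le> e"
    if M: "\<And>m n. m \<ge> M \<Longrightarrow> n \<ge> M \<Longrightarrow> norm (X m - X n) < e" and n: "n \<ge> M" and F: "finite F"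
    for M n e F
  proof (rule tendsto_upperbound[OF _ _ sequentially_bot])
    show "(\<lambda>m. \<Sum>(i, j)\<in>F. cmod (entry (X m) i j - entry (X n) i j))
        \<longlonglongrightarrow> (\<Sum>(i, j)\<in>F. cmod (L i j - entry (X n) i j))"
      unfolding case_prod_unfold by (intro tendsto_intros L)
    show "\<forall>\<^sub>F m in sequentially. (\<Sum>(i, j)\<in>F. cmod (entry (X m) i j - entry (X n) i j)) \<le> e"
      unfolding eventually_sequentially
    proof (intro exI allI impI)
      fix m assume "M \<le> m"
      have "(\<Sum>(i, j)\<in>F. cmod (entry (X m - X n) i j)) \<le> norm (X m - X n)"
        unfolding norm_l1_matrix.rep_eq
        by (rule finite_sum_le_infsum) (use entry_summable F in auto)
      also have "\<dots> \<le> e" using M[OF \<open>M \<le> m\<close> n] by simp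
      finally show "(\<Sum>(i, j)\<in>F. cmod (entry (X m) i j - entry (X n) i j)) \<le> e"
        by (simp add: minus_l1_matrix.rep_eq)
    qed
  qed
  obtain M where M: "\<And>m n. m \<ge> M \<Longrightarrow> n \<ge> M \<Longrightarrow> norm (X m - X n) < 1"
    using CauchyD[OF X zero_less_one] by blast
  have "(\<lambda>(i, j). cmod (L i j - entry (X M) i j)) summable_on UNIV"
    by (rule l1_matrix_bounded(1)[of "\<lambda>i j. L i j - entry (X M) i j"]) (rule close[OF M order.refl])
  from l1_matrix_summable_linear(1)[OF this entry_summable[of "X M"]]
  have "(\<lambda>(i, j). cmod (L i j)) summable_on UNIV" by simp
  then have Lentry: "entry (L1_matrix L) = L" by (simp add: L1_matrix_inverse)
  have "X \<longlonglongrightarrow> L1_matrix L"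
  proof (rule LIMSEQ_I)
    fix e :: real
    assume "0 < e"
    then have "0 < e / 2" by simp
    with X obtain M where M: "\<And>m n. m \<ge> M \<Longrightarrow> n \<ge> M \<Longrightarrow> norm (X m - X n) < e / 2"
      unfolding Cauchy_iff by metis
    have "norm (L1_matrix L - X n) < e" if "n \<ge> M" for n
    proof -
      have "norm (L1_matrix L - X n) \<le> e / 2"
        unfolding norm_l1_matrix.rep_eq minus_l1_matrix.rep_eq Lentry
        by (rule l1_matrix_bounded(2)[of "\<lambda>i j. L i j - entry (X n) i j"]) (rule close[OF M that])
      with \<open>0 < e\<close> show ?thesis by simp
    qed
    then show "\<exists>M. \<forall>n\<ge>M. norm (X n - L1_matrix L) < e"
      by (metis norm_minus_commute)
  qed
  then show "convergent X" by (auto simp: convergent_def)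
next
  fix c and a :: "'a l1_matrix"
  show "norm (c *\<^sub>C a) = cmod c * norm a"
    by transfer (simp only: l1_matrix_summable_scale)
qed (transfer; simp add: algebra_simps)+

end

lemma l1_matrix_summable_row:
  fixes a :: "'i \<Rightarrow> 'i \<Rightarrow> complex"
  assumes "(\<lambda>(i, j). cmod (a i j)) summable_on UNIV"
  shows "(\<lambda>k. cmod (a i k)) summable_on UNIV" "(\<lambda>k. cmod (a k i)) summable_on UNIV"
proof -
  have "(\<lambda>(i, j). cmod (a i j)) summable_on (Pair i ` UNIV)"
    by (rule summable_on_subset_banach[OF assms]) auto
  then show "(\<lambda>k. cmod (a i k)) summable_on UNIV"
    by (subst (asm) summable_on_reindex) (auto simp: inj_on_def o_def)
  have "(\<lambda>(i, j). cmod (a i j)) summable_on ((\<lambda>k. (k, i)) ` UNIV)"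
    by (rule summable_on_subset_banach[OF assms]) auto
  then show "(\<lambda>k. cmod (a k i)) summable_on UNIV"
    by (subst (asm) summable_on_reindex) (auto simp: inj_on_def o_def)
qed

lemma l1_matrix_mult_summable:
  fixes a b :: "'i \<Rightarrow> 'i \<Rightarrow> complex"
  assumes a: "(\<lambda>(i, j). cmod (a i j)) summable_on UNIV"
    and b: "(\<lambda>(i, j). cmod (b i j)) summable_on UNIV"
  shows "(\<lambda>k. a i k * b k j) summable_on UNIV"
proof (rule abs_summable_summable)
  show "(\<lambda>k. norm (a i k * b k j)) summable_on UNIV"
  proof (rule summable_on_comparison_test)
    show "(\<lambda>k. cmod (a i k) * (\<Sum>\<^sub>\<infinity>(i, j). cmod (b i j))) summable_on UNIV"
      by (rule summable_on_cmult_left) (rule l1_matrix_summable_row(1)[OF a])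
  qed (auto simp: norm_mult intro!: mult_left_mono l1_matrix_entry_le[OF b])
qed

lemma l1_matrix_mult_bound:
  fixes a b :: "'i \<Rightarrow> 'i \<Rightarrow> complex"
  assumes a: "(\<lambda>(i, j). cmod (a i j)) summable_on UNIV"
    and b: "(\<lambda>(i, j). cmod (b i j)) summable_on UNIV"
    and F: "finite F"
  shows "(\<Sum>(i, j)\<in>F. cmod (\<Sum>\<^sub>\<infinity>k. a i k * b k j))
    \<le> (\<Sum>\<^sub>\<infinity>(i, j). cmod (a i j)) * (\<Sum>\<^sub>\<infinity>(i, j). cmod (b i j))"
proof -
  let ?A = "\<Sum>\<^sub>\<infinity>(i, j). cmod (a i j)" and ?B = "\<Sum>\<^sub>\<infinity>(i, j). cmod (b i j)"
  have abs: "(\<lambda>k. cmod (a i k) * cmod (b k j)) summable_on UNIV" for i j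
    using l1_matrix_mult_summable[of "\<lambda>i j. of_real (cmod (a i j))" "\<lambda>i j. of_real (cmod (b i j))" i j] a b
    by (simp flip: of_real_mult add: summable_on_iff_abs_summable_on_complex)
  have sums: "(\<lambda>k. \<Sum>p\<in>F. cmod (a (fst p) k) * cmod (b k (snd p))) summable_on UNIV \<and>
      (\<Sum>\<^sub>\<infinity>k. \<Sum>p\<in>F. cmod (a (fst p) k) * cmod (b k (snd p)))
        = (\<Sum>p\<in>F. \<Sum>\<^sub>\<infinity>k. cmod (a (fst p) k) * cmod (b k (snd p)))"
    using F
  proof (induction F rule: finite_induct)
    case (insert p F)
    then show ?case by (auto simp: infsum_add abs intro!: summable_on_add)
  qed simp
  have "(\<Sum>(i, j)\<in>F. cmod (\<Sum>\<^sub>\<infinity>k. a i k * b k j))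
      \<le> (\<Sum>p\<in>F. \<Sum>\<^sub>\<infinity>k. cmod (a (fst p) k) * cmod (b k (snd p)))"
    by (rule sum_mono)
      (use norm_infsum_bound[of "\<lambda>k. a _ k * b k _" UNIV] abs in
        \<open>auto simp: norm_mult case_prod_unfold\<close>)
  also have "\<dots> = (\<Sum>\<^sub>\<infinity>k. \<Sum>p\<in>F. cmod (a (fst p) k) * cmod (b k (snd p)))"
    using sums by simp
  also have "\<dots> \<le> ?A * ?B"
  proof (rule infsum_le_finite_sums)
    show "(\<lambda>k. \<Sum>p\<in>F. cmod (a (fst p) k) * cmod (b k (snd p))) summable_on UNIV"
      using sums by simp
    fix G :: "'i set"
    assume G: "finite G" "G \<subseteq> UNIV"
    let ?I = "fst ` F" and ?J = "snd ` F"
    have row: "(\<Sum>j\<in>?J. cmod (b k j)) \<le> ?B" for k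
    proof -
      have "(\<Sum>j\<in>?J. cmod (b k j)) = (\<Sum>(i, j)\<in>{k} \<times> ?J. cmod (b i j))"
        by (simp flip: sum.cartesian_product)
      also have "\<dots> \<le> ?B"
        by (rule finite_sum_le_infsum[OF b]) (use F in auto)
      finally show ?thesis .
    qed
    have "(\<Sum>k\<in>G. \<Sum>p\<in>F. cmod (a (fst p) k) * cmod (b k (snd p)))
        \<le> (\<Sum>k\<in>G. \<Sum>p\<in>?I \<times> ?J. cmod (a (fst p) k) * cmod (b k (snd p)))"
      by (intro sum_mono sum_mono2) (use F in \<open>auto intro: rev_image_eqI\<close>)
    also have "\<dots> = (\<Sum>k\<in>G. \<Sum>i\<in>?I. cmod (a i k) * (\<Sum>j\<in>?J. cmod (b k j)))"
      by (simp add: sum.cartesian_product' sum_distrib_left)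
    also have "\<dots> \<le> (\<Sum>k\<in>G. \<Sum>i\<in>?I. cmod (a i k) * ?B)"
      by (intro sum_mono mult_left_mono row) auto
    also have "\<dots> = (\<Sum>(i, k)\<in>?I \<times> G. cmod (a i k)) * ?B"
      by (simp add: sum_distrib_right sum.swap[of _ G] flip: sum.cartesian_product)
    also have "\<dots> \<le> ?A * ?B"
    proof (rule mult_right_mono)
      show "(\<Sum>(i, k)\<in>?I \<times> G. cmod (a i k)) \<le> ?A"
        by (rule finite_sum_le_infsum[OF a]) (use F G in auto)
    qed (auto intro!: infsum_nonneg)
    finally show "(\<Sum>k\<in>G. \<Sum>p\<in>F. cmod (a (fst p) k) * cmod (b k (snd p))) \<le> ?A * ?B" .
  qed
  finally show ?thesis .
qed

lemma l1_matrix_mult_assoc: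
  fixes a b c :: "'i \<Rightarrow> 'i \<Rightarrow> complex"
  assumes a: "(\<lambda>(i, j). cmod (a i j)) summable_on UNIV"
    and b: "(\<lambda>(i, j). cmod (b i j)) summable_on UNIV"
    and c: "(\<lambda>(i, j). cmod (c i j)) summable_on UNIV"
  shows "(\<Sum>\<^sub>\<infinity>l. (\<Sum>\<^sub>\<infinity>k. a i k * b k l) * c l j) = (\<Sum>\<^sub>\<infinity>k. a i k * (\<Sum>\<^sub>\<infinity>l. b k l * c l j))"
proof -
  let ?A = "\<Sum>\<^sub>\<infinity>(i, j). cmod (a i j)" and ?C = "\<Sum>\<^sub>\<infinity>(i, j). cmod (c i j)"
  have sm: "(\<lambda>(k, l). a i k * b k l * c l j) summable_on UNIV"
  proof (rule abs_summable_summable, rule summable_on_comparison_test)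
    show "(\<lambda>p. (?A * ?C) * (\<lambda>(k, l). cmod (b k l)) p) summable_on UNIV"
      by (rule summable_on_cmult_right[OF b])
    fix p :: "'i \<times> 'i"
    obtain k l where p: "p = (k, l)" by force
    have "cmod (a i k) * cmod (b k l) * cmod (c l j) = (cmod (a i k) * cmod (c l j)) * cmod (b k l)"
      by simp
    also have "\<dots> \<le> (?A * ?C) * cmod (b k l)"
      by (intro mult_right_mono mult_mono l1_matrix_entry_le a c infsum_nonneg) auto
    finally show "cmod (case p of (k, l) \<Rightarrow> a i k * b k l * c l j)
        \<le> (?A * ?C) * (\<lambda>(k, l). cmod (b k l)) p"
      by (simp add: p norm_mult)
  qed auto
  have "(\<Sum>\<^sub>\<infinity>l. (\<Sum>\<^sub>\<infinity>k. a i k * b k l) * c l j) = (\<Sum>\<^sub>\<infinity>l. \<Sum>\<^sub>\<infinity>k. a i k * b k l * c l j)"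
    by (intro infsum_cong infsum_cmult_left[symmetric] l1_matrix_mult_summable a b)
  also have "\<dots> = (\<Sum>\<^sub>\<infinity>k. \<Sum>\<^sub>\<infinity>l. a i k * b k l * c l j)"
    by (rule infsum_swap_banach[symmetric]) (use sm in simp)
  also have "\<dots> = (\<Sum>\<^sub>\<infinity>k. a i k * (\<Sum>\<^sub>\<infinity>l. b k l * c l j))"
    unfolding mult.assoc
    by (intro infsum_cong infsum_cmult_right l1_matrix_mult_summable b c)
  finally show ?thesis .
qed

instantiation l1_matrix :: (type) complex_banach_algebra
begin

lift_definition times_l1_matrix :: "'a l1_matrix \<Rightarrow> 'a l1_matrix \<Rightarrow> 'a l1_matrix"
  is "\<lambda>a b i j. \<Sum>\<^sub>\<infinity>k. a i k * b k j"
  by (rule l1_matrix_bounded(1)) (rule l1_matrix_mult_bound)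

instance
proof
  fix a b c :: "'a l1_matrix" and r :: real and z :: complex
  show "a * b * c = a * (b * c)"
    by transfer (intro ext l1_matrix_mult_assoc)
  show "(a + b) * c = a * c + b * c"
    by transfer (intro ext, simp add: distrib_right infsum_add l1_matrix_mult_summable)
  show "a * (b + c) = a * b + a * c"
    by transfer (intro ext, simp add: distrib_left infsum_add l1_matrix_mult_summable)
  show C1: "(z *\<^sub>C a) * b = z *\<^sub>C (a * b)" for z
    by transfer (intro ext, simp add: mult.assoc infsum_cmult_right l1_matrix_mult_summable)
  show C2: "a * (z *\<^sub>C b) = z *\<^sub>C (a * b)" for z
    by transfer (intro ext, simp add: mult.left_commute infsum_cmult_right l1_matrix_mult_summable)
  show "(r *\<^sub>R a) * b = r *\<^sub>R (a * b)" "a * (r *\<^sub>R b) = r *\<^sub>R (a * b)"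
    by (simp_all add: scaleR_scaleC C1 C2)
  show "norm (a * b) \<le> norm a * norm b"
    by transfer (rule l1_matrix_bounded(2), rule l1_matrix_mult_bound)
qed

end


section \<open>The projective tensor product\<close>

definition formal_scale :: "complex \<Rightarrow> ('k \<Rightarrow>\<^sub>0 complex) \<Rightarrow> ('k \<Rightarrow>\<^sub>0 complex)"
  where "formal_scale c = Poly_Mapping.map ((*) c)"

lemma lookup_formal_scale [simp]:
  "Poly_Mapping.lookup (formal_scale c u) k = c * Poly_Mapping.lookup u k"
  by (simp add: formal_scale_def Poly_Mapping.map.rep_eq when_def)

interpretation formal: vector_space "formal_scale :: complex \<Rightarrow> ('k \<Rightarrow>\<^sub>0 complex) \<Rightarrow> _"
  by standard (auto intro!: poly_mapping_eqI simp: lookup_add algebra_simps)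

abbreviation formal_single :: "'k \<Rightarrow> ('k \<Rightarrow>\<^sub>0 complex)"
  where "formal_single k \<equiv> Poly_Mapping.single k 1"

lemma formal_scale_single: "formal_scale c (Poly_Mapping.single k d) = Poly_Mapping.single k (c * d)"
  by (rule poly_mapping_eqI) (simp add: lookup_single when_def)

text \<open>
  The algebraic tensor product is the space of formal linear combinations of pairs modulo
  \<open>tensor_null\<close>.  The infimum of \<open>\<Sum> \<parallel>a\<^sub>i\<parallel> \<parallel>b\<^sub>i\<parallel>\<close> over all representations
  \<open>\<Sum> a\<^sub>i \<otimes> b\<^sub>i\<close> of the class of \<open>u\<close> is taken directly on formal combinations, and the type
  \<open>ptensor\<close> is the Hausdorff completion (Cauchy sequences modulo null sequences) with respect to it.
\<close>

definition tensor_relations :: "('a::complex_banach \<times> 'b::complex_banach \<Rightarrow>\<^sub>0 complex) set"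
  where "tensor_relations =
    {formal_single (a + a', b) - formal_single (a, b) - formal_single (a', b) | a a' b. True} \<union>
    {formal_single (a, b + b') - formal_single (a, b) - formal_single (a, b') | a b b'. True} \<union>
    {formal_single (c *\<^sub>C a, b) - formal_scale c (formal_single (a, b)) | c a b. True} \<union>
    {formal_single (a, c *\<^sub>C b) - formal_scale c (formal_single (a, b)) | c a b. True}"

abbreviation tensor_null :: "('a::complex_banach \<times> 'b::complex_banach \<Rightarrow>\<^sub>0 complex) set"
  where "tensor_null \<equiv> formal.span tensor_relations"

definition projective_norm :: "('a::complex_banach \<times> 'b::complex_banach \<Rightarrow>\<^sub>0 complex) \<Rightarrow> real"
  where "projective_norm u =
    Inf {(\<Sum>(a, b)\<leftarrow>xs. norm a * norm b) | xs. u - (\<Sum>p\<leftarrow>xs. formal_single p) \<in> tensor_null}"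

lemma tensor_relations_scale_left:
  "formal_single (c *\<^sub>C a, b) - formal_scale c (formal_single (a, b)) \<in> tensor_null"
  by (rule formal.span_base) (force simp: tensor_relations_def)

lemma formal_expansion:
  "u = (\<Sum>k\<in>Poly_Mapping.keys u. formal_scale (Poly_Mapping.lookup u k) (formal_single k))"
  by (rule poly_mapping_eqI)
    (auto simp: lookup_sum lookup_single when_def in_keys_iff if_distrib[of "(*) _"] cong: if_cong)

lemma sum_list_norm_nonneg:
  "0 \<le> (\<Sum>(a, b)\<leftarrow>xs. norm a * norm b)" for xs :: "('a::complex_banach \<times> 'b::complex_banach) list"
  by (rule sum_list_nonneg) auto

lemma projective_norm_upper:
  assumes "u - (\<Sum>p\<leftarrow>xs. formal_single p) \<in> tensor_null"
  shows "projective_norm u \<le> (\<Sum>(a, b)\<leftarrow>xs. norm a * norm b)"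
  unfolding projective_norm_def
  by (rule cInf_lower) (use assms sum_list_norm_nonneg in \<open>auto intro!: bdd_belowI[of _ 0]\<close>)

lemma formal_representation:
  fixes u :: "'a::complex_banach \<times> 'b::complex_banach \<Rightarrow>\<^sub>0 complex"
  shows "\<exists>xs. u - (\<Sum>p\<leftarrow>xs. formal_single p) \<in> tensor_null"
proof -
  have "\<exists>xs. (\<Sum>k\<in>K. formal_scale (f k) (formal_single k)) - (\<Sum>p\<leftarrow>xs. formal_single p) \<in> tensor_null"
    if "finite K" for K :: "('a \<times> 'b) set" and f
    using that
  proof (induction K rule: finite_induct)
    case empty
    show ?case by (rule exI[of _ "[]"]) (simp add: formal.span_zero)
  next
    case (insert k K)
    obtain xs where xs: "(\<Sum>k\<in>K. formal_scale (f k) (formal_single k)) - (\<Sum>p\<leftarrow>xs. formal_single p) \<in> tensor_null"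
      using insert by auto
    obtain a b where k: "k = (a, b)" by force
    have "((\<Sum>k\<in>K. formal_scale (f k) (formal_single k)) - (\<Sum>p\<leftarrow>xs. formal_single p))
        - (formal_single (f k *\<^sub>C a, b) - formal_scale (f k) (formal_single (a, b))) \<in> tensor_null"
      by (intro formal.span_diff xs tensor_relations_scale_left)
    then show ?case
      using insert by (intro exI[of _ "(f k *\<^sub>C a, b) # xs"]) (simp add: k algebra_simps)
  qed
  from this[of "Poly_Mapping.keys u" "Poly_Mapping.lookup u"] show ?thesis
    by (simp flip: formal_expansion)
qed

lemma projective_norm_witness:
  assumes "projective_norm u < r"
  obtains xs where "u - (\<Sum>p\<leftarrow>xs. formal_single p) \<in> tensor_null"
    "(\<Sum>(a, b)\<leftarrow>xs. norm a * norm b) < r"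
proof -
  let ?S = "{(\<Sum>(a, b)\<leftarrow>xs. norm a * norm b) | xs. u - (\<Sum>p\<leftarrow>xs. formal_single p) \<in> tensor_null}"
  have "\<exists>x\<in>?S. x < r"
    by (rule cInf_lessD) (use assms formal_representation[of u] in \<open>auto simp: projective_norm_def\<close>)
  then show ?thesis using that by auto
qed

lemma projective_norm_nonneg:
  fixes u :: "'a::complex_banach \<times> 'b::complex_banach \<Rightarrow>\<^sub>0 complex"
  shows "0 \<le> projective_norm u"
proof (rule ccontr)
  assume "\<not> 0 \<le> projective_norm u"
  then have "projective_norm u < 0" by simp
  then obtain xs :: "('a \<times> 'b) list" where "(\<Sum>(a, b)\<leftarrow>xs. norm a * norm b) < 0"
    by (rule projective_norm_witness)
  with sum_list_norm_nonneg[of xs] show False by simp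
qed

lemma projective_norm_zero: "projective_norm 0 = 0"
proof (rule antisym[OF _ projective_norm_nonneg])
  show "projective_norm (0 :: 'a \<times> 'b \<Rightarrow>\<^sub>0 complex) \<le> 0"
    using projective_norm_upper[of "0 :: 'a \<times> 'b \<Rightarrow>\<^sub>0 complex" "[]"] by (simp add: formal.span_zero)
qed

lemma projective_norm_single: "projective_norm (formal_single (a, b)) \<le> norm a * norm b"
  using projective_norm_upper[of "formal_single (a, b)" "[(a, b)]"] by (simp add: formal.span_zero)

lemma projective_norm_add: "projective_norm (u + v) \<le> projective_norm u + projective_norm v"
proof (rule field_le_epsilon)
  fix e :: real
  assume "0 < e"
  then have "projective_norm u < projective_norm u + e / 2" "projective_norm v < projective_norm v + e / 2"
    by auto
  from this(1) obtain xs where xs: "u - (\<Sum>p\<leftarrow>xs. formal_single p) \<in> tensor_null"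
    "(\<Sum>(a, b)\<leftarrow>xs. norm a * norm b) < projective_norm u + e / 2" by (rule projective_norm_witness)
  obtain ys where ys: "v - (\<Sum>p\<leftarrow>ys. formal_single p) \<in> tensor_null"
    "(\<Sum>(a, b)\<leftarrow>ys. norm a * norm b) < projective_norm v + e / 2"
    using \<open>projective_norm v < projective_norm v + e / 2\<close> by (rule projective_norm_witness)
  have "(u + v) - (\<Sum>p\<leftarrow>xs @ ys. formal_single p) \<in> tensor_null"
    using formal.span_add[OF xs(1) ys(1)] by (simp add: algebra_simps)
  from projective_norm_upper[OF this] xs(2) ys(2)
  show "projective_norm (u + v) \<le> projective_norm u + projective_norm v + e" by simp
qed

lemma projective_norm_scale_le: "projective_norm (formal_scale c u) \<le> cmod c * projective_norm u"
proof (rule field_le_epsilon)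
  fix e :: real
  assume e: "0 < e"
  define d where "d = e / (cmod c + 1)"
  have pos: "cmod c + 1 > 0" by (smt (verit) norm_ge_zero)
  have d: "0 < d" using e pos by (simp add: d_def)
  then have "projective_norm u < projective_norm u + d" by simp
  then obtain xs where xs: "u - (\<Sum>p\<leftarrow>xs. formal_single p) \<in> tensor_null"
    "(\<Sum>(a, b)\<leftarrow>xs. norm a * norm b) < projective_norm u + d" by (rule projective_norm_witness)
  define ys where "ys = map (\<lambda>(a, b). (c *\<^sub>C a, b)) xs"
  have "(\<Sum>p\<leftarrow>map (\<lambda>(a, b). (c *\<^sub>C a, b)) zs. formal_single p)
      - formal_scale c (\<Sum>p\<leftarrow>zs. formal_single p) \<in> tensor_null" for zs :: "('a \<times> 'b) list"
  proof (induction zs)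
    case Nil
    show ?case by (simp add: formal.span_zero)
  next
    case (Cons p zs)
    obtain a b where p: "p = (a, b)" by force
    from formal.span_add[OF Cons tensor_relations_scale_left[of c a b]]
    show ?case by (simp add: p formal.scale_right_distrib algebra_simps)
  qed
  then have "(\<Sum>p\<leftarrow>ys. formal_single p) - formal_scale c (\<Sum>p\<leftarrow>xs. formal_single p) \<in> tensor_null"
    by (simp add: ys_def)
  from formal.span_diff[OF formal.span_scale[OF xs(1), of c] this]
  have "formal_scale c u - (\<Sum>p\<leftarrow>ys. formal_single p) \<in> tensor_null"
    by (simp add: formal.scale_right_diff_distrib algebra_simps)
  then have "projective_norm (formal_scale c u) \<le> (\<Sum>(a, b)\<leftarrow>ys. norm a * norm b)"
    by (rule projective_norm_upper)
  also have "\<dots> = cmod c * (\<Sum>(a, b)\<leftarrow>xs. norm a * norm b)"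
    by (simp add: ys_def o_def case_prod_unfold norm_scaleC mult.assoc sum_list_const_mult)
  also have "\<dots> \<le> cmod c * (projective_norm u + d)"
    by (intro mult_left_mono) (use xs in auto)
  also have "\<dots> = cmod c * projective_norm u + e * (cmod c / (cmod c + 1))"
    by (simp add: d_def algebra_simps)
  also have "\<dots> \<le> cmod c * projective_norm u + e * 1"
    by (intro add_left_mono mult_left_mono) (use e pos in auto)
  finally show "projective_norm (formal_scale c u) \<le> cmod c * projective_norm u + e" by simp
qed

lemma projective_norm_scale: "projective_norm (formal_scale c u) = cmod c * projective_norm u"
proof (cases "c = 0")
  case True
  then show ?thesis by (simp add: projective_norm_zero)
next
  case False
  have "projective_norm u \<le> inverse (cmod c) * projective_norm (formal_scale c u)"
    using projective_norm_scale_le[of "inverse c" "formal_scale c u"] False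
    by (simp add: norm_inverse)
  then have "cmod c * projective_norm u \<le> projective_norm (formal_scale c u)"
    using False by (simp add: field_simps)
  with projective_norm_scale_le[of c u] show ?thesis by simp
qed

lemma projective_norm_minus: "projective_norm (- u) = projective_norm u"
  using projective_norm_scale[of "-1" u] by (simp add: formal.scale_minus_left)

lemma projective_norm_diff: "projective_norm (u - v) \<le> projective_norm u + projective_norm v"
  using projective_norm_add[of u "- v"] by (simp add: projective_norm_minus)

lemma projective_norm_diff_commute: "projective_norm (u - v) = projective_norm (v - u)"
  using projective_norm_minus[of "u - v"] by simp

lemma projective_norm_triangle:
  "projective_norm (u - w) \<le> projective_norm (u - v) + projective_norm (v - w)"
  using projective_norm_add[of "u - v" "v - w"] by simp

lemma projective_norm_reverse: "\<bar>projective_norm u - projective_norm v\<bar> \<le> projective_norm (u - v)"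
  using projective_norm_add[of "u - v" v] projective_norm_add[of "v - u" u]
    projective_norm_diff_commute[of u v] by simp

lemma projective_norm_null:
  assumes "u \<in> tensor_null"
  shows "projective_norm u = 0"
  using projective_norm_upper[of u "[]"] assms projective_norm_nonneg[of u] by simp

definition projective_Cauchy :: "(nat \<Rightarrow> 'a::complex_banach \<times> 'b::complex_banach \<Rightarrow>\<^sub>0 complex) \<Rightarrow> bool"
  where "projective_Cauchy s \<longleftrightarrow> (\<forall>e>0. \<exists>N. \<forall>m\<ge>N. \<forall>n\<ge>N. projective_norm (s m - s n) < e)"

definition projective_rel ::
    "(nat \<Rightarrow> 'a::complex_banach \<times> 'b::complex_banach \<Rightarrow>\<^sub>0 complex) \<Rightarrow> (nat \<Rightarrow> 'a \<times> 'b \<Rightarrow>\<^sub>0 complex) \<Rightarrow> bool"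
  where "projective_rel s t \<longleftrightarrow> projective_Cauchy s \<and> projective_Cauchy t \<and>
    (\<lambda>n. projective_norm (s n - t n)) \<longlonglongrightarrow> 0"

lemma tendsto_zero_squeeze:
  fixes f g :: "'i \<Rightarrow> real"
  assumes "(g \<longlongrightarrow> 0) F" "\<And>n. 0 \<le> f n" "\<And>n. f n \<le> g n"
  shows "(f \<longlongrightarrow> 0) F"
  by (rule tendsto_sandwich[OF _ _ tendsto_const assms(1)]) (auto simp: assms)

lemma projective_Cauchy_const: "projective_Cauchy (\<lambda>_. u)"
  by (simp add: projective_Cauchy_def projective_norm_zero)

lemma projective_Cauchy_add:
  assumes "projective_Cauchy s" "projective_Cauchy t"
  shows "projective_Cauchy (\<lambda>n. s n + t n)"
  unfolding projective_Cauchy_def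
proof (intro allI impI)
  fix e :: real
  assume "0 < e"
  then have "0 < e / 2" by simp
  with assms obtain M N where M: "\<And>m n. m \<ge> M \<Longrightarrow> n \<ge> M \<Longrightarrow> projective_norm (s m - s n) < e / 2"
    and N: "\<And>m n. m \<ge> N \<Longrightarrow> n \<ge> N \<Longrightarrow> projective_norm (t m - t n) < e / 2"
    unfolding projective_Cauchy_def by metis
  show "\<exists>N. \<forall>m\<ge>N. \<forall>n\<ge>N. projective_norm (s m + t m - (s n + t n)) < e"
  proof (intro exI allI impI)
    fix m n assume "max M N \<le> m" "max M N \<le> n"
    with M[of m n] N[of m n] projective_norm_add[of "s m - s n" "t m - t n"]
    show "projective_norm (s m + t m - (s n + t n)) < e" by (simp add: algebra_simps)
  qed
qed

lemma projective_Cauchy_scale: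
  assumes "projective_Cauchy s"
  shows "projective_Cauchy (\<lambda>n. formal_scale c (s n))"
  unfolding projective_Cauchy_def
proof (intro allI impI)
  fix e :: real
  assume e: "0 < e"
  have pos: "cmod c + 1 > 0" by (smt (verit) norm_ge_zero)
  then have "0 < e / (cmod c + 1)" using e by simp
  with assms obtain N where N: "\<And>m n. m \<ge> N \<Longrightarrow> n \<ge> N \<Longrightarrow> projective_norm (s m - s n) < e / (cmod c + 1)"
    unfolding projective_Cauchy_def by metis
  show "\<exists>N. \<forall>m\<ge>N. \<forall>n\<ge>N. projective_norm (formal_scale c (s m) - formal_scale c (s n)) < e"
  proof (intro exI allI impI)
    fix m n assume mn: "N \<le> m" "N \<le> n"
    have "projective_norm (formal_scale c (s m) - formal_scale c (s n)) = cmod c * projective_norm (s m - s n)"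
      by (simp flip: projective_norm_scale add: formal.scale_right_diff_distrib)
    also have "\<dots> \<le> (cmod c + 1) * projective_norm (s m - s n)"
      by (intro mult_right_mono projective_norm_nonneg) auto
    also have "\<dots> < e" using N[OF mn] pos by (simp add: field_simps)
    finally show "projective_norm (formal_scale c (s m) - formal_scale c (s n)) < e" .
  qed
qed

lemma projective_rel_refl: "projective_rel s s \<longleftrightarrow> projective_Cauchy s"
  by (auto simp: projective_rel_def projective_norm_zero)

lemma projective_rel_add:
  assumes "projective_rel s s'" "projective_rel t t'"
  shows "projective_rel (\<lambda>n. s n + t n) (\<lambda>n. s' n + t' n)"
proof -
  have "(\<lambda>n. projective_norm (s n + t n - (s' n + t' n))) \<longlonglongrightarrow> 0"
  proof (rule tendsto_zero_squeeze)
    show "(\<lambda>n. projective_norm (s n - s' n) + projective_norm (t n - t' n)) \<longlonglongrightarrow> 0"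
      using assms unfolding projective_rel_def by (auto intro: tendsto_add_zero)
    show "projective_norm (s n + t n - (s' n + t' n))
        \<le> projective_norm (s n - s' n) + projective_norm (t n - t' n)" for n
      using projective_norm_add[of "s n - s' n" "t n - t' n"] by (simp add: algebra_simps)
  qed (rule projective_norm_nonneg)
  then show ?thesis using assms by (auto simp: projective_rel_def projective_Cauchy_add)
qed

lemma projective_rel_scale:
  assumes "projective_rel s t"
  shows "projective_rel (\<lambda>n. formal_scale c (s n)) (\<lambda>n. formal_scale c (t n))"
proof -
  have "(\<lambda>n. projective_norm (formal_scale c (s n) - formal_scale c (t n))) \<longlonglongrightarrow> 0"
    using assms unfolding projective_rel_def formal.scale_right_diff_distrib[symmetric] projective_norm_scale
    by (auto intro: tendsto_mult_right_zero)
  then show ?thesis using assms by (auto simp: projective_rel_def projective_Cauchy_scale)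
qed

lemma part_equivp_projective_rel: "part_equivp projective_rel"
proof (rule part_equivpI)
  show "\<exists>s. projective_rel s s" by (auto simp: projective_rel_refl intro: projective_Cauchy_const)
  show "symp projective_rel"
    by (auto simp: symp_def projective_rel_def projective_norm_diff_commute)
  show "transp projective_rel"
  proof (rule transpI)
    fix s t u assume *: "projective_rel s t" "projective_rel t u"
    have "(\<lambda>n. projective_norm (s n - u n)) \<longlonglongrightarrow> 0"
    proof (rule tendsto_zero_squeeze)
      show "(\<lambda>n. projective_norm (s n - t n) + projective_norm (t n - u n)) \<longlonglongrightarrow> 0"
        using * unfolding projective_rel_def by (auto intro: tendsto_add_zero)
    qed (rule projective_norm_nonneg projective_norm_triangle)+
    then show "projective_rel s u" using * by (auto simp: projective_rel_def)
  qed
qed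

quotient_type (overloaded) ('a, 'b) ptensor =
  "nat \<Rightarrow> 'a::complex_banach \<times> 'b::complex_banach \<Rightarrow>\<^sub>0 complex" / partial: projective_rel
  by (rule part_equivp_projective_rel)

lemma projective_Cauchy_norm:
  assumes "projective_Cauchy s"
  shows "convergent (\<lambda>n. projective_norm (s n))"
proof -
  have "Cauchy (\<lambda>n. projective_norm (s n))"
    unfolding Cauchy_iff real_norm_def
    using assms unfolding projective_Cauchy_def
    by (meson projective_norm_reverse le_less_trans)
  then show ?thesis by (simp add: Cauchy_convergent_iff)
qed

lemma projective_rel_norm:
  assumes "projective_rel s t"
  shows "lim (\<lambda>n. projective_norm (s n)) = lim (\<lambda>n. projective_norm (t n))"
proof -
  have s: "(\<lambda>n. projective_norm (s n)) \<longlonglongrightarrow> lim (\<lambda>n. projective_norm (s n))"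
    using assms by (simp add: projective_rel_def projective_Cauchy_norm flip: convergent_LIMSEQ_iff)
  have t: "(\<lambda>n. projective_norm (t n)) \<longlonglongrightarrow> lim (\<lambda>n. projective_norm (t n))"
    using assms by (simp add: projective_rel_def projective_Cauchy_norm flip: convergent_LIMSEQ_iff)
  have "(\<lambda>n. \<bar>projective_norm (s n) - projective_norm (t n)\<bar>) \<longlonglongrightarrow> 0"
    by (rule tendsto_zero_squeeze[of "\<lambda>n. projective_norm (s n - t n)"])
      (use assms projective_norm_reverse in \<open>auto simp: projective_rel_def\<close>)
  then have "(\<lambda>n. projective_norm (s n) - projective_norm (t n)) \<longlonglongrightarrow> 0"
    by (simp add: tendsto_rabs_zero_iff)
  from LIMSEQ_unique[OF this tendsto_diff[OF s t]] show ?thesis by simp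
qed

instantiation ptensor :: (complex_banach, complex_banach) real_normed_vector
begin

lift_definition norm_ptensor :: "('a, 'b) ptensor \<Rightarrow> real"
  is "\<lambda>s. lim (\<lambda>n. projective_norm (s n))"
  by (rule projective_rel_norm)

lift_definition zero_ptensor :: "('a, 'b) ptensor" is "\<lambda>_. 0"
  by (simp add: projective_rel_refl projective_Cauchy_const)

lift_definition plus_ptensor :: "('a, 'b) ptensor \<Rightarrow> ('a, 'b) ptensor \<Rightarrow> ('a, 'b) ptensor"
  is "\<lambda>s t n. s n + t n"
  by (rule projective_rel_add)

lift_definition minus_ptensor :: "('a, 'b) ptensor \<Rightarrow> ('a, 'b) ptensor \<Rightarrow> ('a, 'b) ptensor"
  is "\<lambda>s t n. s n - t n"
proof -
  fix s s' t t' :: "nat \<Rightarrow> 'a \<times> 'b \<Rightarrow>\<^sub>0 complex"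
  assume "projective_rel s s'" "projective_rel t t'"
  from projective_rel_add[OF this(1) projective_rel_scale[OF this(2), of "-1"]]
  show "projective_rel (\<lambda>n. s n - t n) (\<lambda>n. s' n - t' n)"
    by (simp add: formal.scale_minus_left)
qed

lift_definition uminus_ptensor :: "('a, 'b) ptensor \<Rightarrow> ('a, 'b) ptensor" is "\<lambda>s n. - s n"
proof -
  fix s t :: "nat \<Rightarrow> 'a \<times> 'b \<Rightarrow>\<^sub>0 complex"
  assume "projective_rel s t"
  from projective_rel_scale[OF this, of "-1"]
  show "projective_rel (\<lambda>n. - s n) (\<lambda>n. - t n)"
    by (simp add: formal.scale_minus_left)
qed

lift_definition scaleR_ptensor :: "real \<Rightarrow> ('a, 'b) ptensor \<Rightarrow> ('a, 'b) ptensor"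
  is "\<lambda>r s n. formal_scale (complex_of_real r) (s n)"
  by (rule projective_rel_scale)

definition dist_ptensor :: "('a, 'b) ptensor \<Rightarrow> ('a, 'b) ptensor \<Rightarrow> real"
  where "dist_ptensor a b = norm (a - b)"

definition [code del]:
  "(uniformity :: (('a, 'b) ptensor \<times> ('a, 'b) ptensor) filter)
    = (INF e\<in>{0 <..}. principal {(x, y). dist x y < e})"

definition open_ptensor :: "('a, 'b) ptensor set \<Rightarrow> bool"
  where [code del]: "open_ptensor S = (\<forall>x\<in>S. \<forall>\<^sub>F (x', y) in uniformity. x' = x \<longrightarrow> y \<in> S)"

definition sgn_ptensor :: "('a, 'b) ptensor \<Rightarrow> ('a, 'b) ptensor"
  where "sgn_ptensor x = scaleR (inverse (norm x)) x"

lemma ptensor_cases: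
  obtains s where "projective_Cauchy s" "x = abs_ptensor s"
  by (metis Quotient_abs_rep[OF Quotient_ptensor] Quotient_rep_reflp[OF Quotient_ptensor] projective_rel_refl)

lemma ptensor_eq_iff:
  assumes "projective_Cauchy s" "projective_Cauchy t"
  shows "abs_ptensor s = abs_ptensor t \<longleftrightarrow> (\<lambda>n. projective_norm (s n - t n)) \<longlonglongrightarrow> 0"
  using Quotient_rel[OF Quotient_ptensor, of s t] assms
  by (simp add: projective_rel_refl) (simp add: projective_rel_def)

lemmas ptensor_abs_eqs =
  norm_ptensor.abs_eq plus_ptensor.abs_eq minus_ptensor.abs_eq uminus_ptensor.abs_eq scaleR_ptensor.abs_eq

lemma norm_ptensor_LIMSEQ:
  "projective_Cauchy s \<Longrightarrow> (\<lambda>n. projective_norm (s n)) \<longlonglongrightarrow> norm (abs_ptensor s)"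
  by (simp add: norm_ptensor.abs_eq projective_rel_refl projective_Cauchy_norm flip: convergent_LIMSEQ_iff)

instance
proof
  fix x y z :: "('a, 'b) ptensor" and r q :: real
  obtain s where s: "projective_Cauchy s" "x = abs_ptensor s" by (rule ptensor_cases)
  obtain t where t: "projective_Cauchy t" "y = abs_ptensor t" by (rule ptensor_cases)
  obtain u where u: "projective_Cauchy u" "z = abs_ptensor u" by (rule ptensor_cases)
  note eqs = s t u ptensor_abs_eqs zero_ptensor_def projective_rel_refl projective_Cauchy_add
    projective_Cauchy_scale projective_Cauchy_const
  show "x + y + z = x + (y + z)" "x + y = y + x" "0 + x = x"
    by (simp_all add: eqs add_ac)
  show "- x + x = 0"
    using projective_Cauchy_scale[OF s(1), of "-1"]
    by (simp add: eqs formal.scale_minus_left)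
  show "x - y = x + - y"
    using projective_Cauchy_scale[OF t(1), of "-1"]
    by (simp add: eqs formal.scale_minus_left)
  show "r *\<^sub>R (x + y) = r *\<^sub>R x + r *\<^sub>R y" "(r + q) *\<^sub>R x = r *\<^sub>R x + q *\<^sub>R x"
    "r *\<^sub>R q *\<^sub>R x = (r * q) *\<^sub>R x" "1 *\<^sub>R x = x"
    by (simp_all add: eqs formal.scale_right_distrib formal.scale_left_distrib)
  show "(norm x = 0) = (x = 0)"
  proof
    assume "norm x = 0"
    with norm_ptensor_LIMSEQ[OF s(1)] show "x = 0"
      by (simp add: s zero_ptensor_def ptensor_eq_iff projective_Cauchy_const)
  qed (simp add: zero_ptensor_def ptensor_abs_eqs projective_rel_refl projective_Cauchy_const
      projective_norm_zero)
  show "norm (x + y) \<le> norm x + norm y"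
  proof (rule LIMSEQ_le)
    show "(\<lambda>n. projective_norm (s n + t n)) \<longlonglongrightarrow> norm (x + y)"
      using norm_ptensor_LIMSEQ[OF projective_Cauchy_add[OF s(1) t(1)]] by (simp add: eqs)
    show "(\<lambda>n. projective_norm (s n) + projective_norm (t n)) \<longlonglongrightarrow> norm x + norm y"
      using norm_ptensor_LIMSEQ s t by (auto intro: tendsto_add)
  qed (auto intro: projective_norm_add)
  show "norm (r *\<^sub>R x) = \<bar>r\<bar> * norm x"
  proof (rule LIMSEQ_unique)
    show "(\<lambda>n. projective_norm (formal_scale (complex_of_real r) (s n))) \<longlonglongrightarrow> norm (r *\<^sub>R x)"
      using norm_ptensor_LIMSEQ[OF projective_Cauchy_scale[OF s(1), of r]] by (simp add: eqs)
    show "(\<lambda>n. projective_norm (formal_scale (complex_of_real r) (s n))) \<longlonglongrightarrow> \<bar>r\<bar> * norm x"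
      using norm_ptensor_LIMSEQ[OF s(1)] by (auto simp: projective_norm_scale s intro: tendsto_mult)
  qed
qed (simp_all only: dist_ptensor_def open_ptensor_def sgn_ptensor_def uniformity_ptensor_def)

end

definition formal_to_ptensor ::
    "('a::complex_banach \<times> 'b::complex_banach \<Rightarrow>\<^sub>0 complex) \<Rightarrow> ('a, 'b) ptensor"
  where "formal_to_ptensor u = abs_ptensor (\<lambda>_. u)"

lemma norm_formal_to_ptensor: "norm (formal_to_ptensor u) = projective_norm u"
  by (simp add: formal_to_ptensor_def ptensor_abs_eqs projective_rel_refl projective_Cauchy_const)

lemma formal_to_ptensor_diff:
  "formal_to_ptensor (u - v) = formal_to_ptensor u - formal_to_ptensor v"
  by (simp add: formal_to_ptensor_def ptensor_abs_eqs projective_rel_refl projective_Cauchy_const)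

lemma formal_to_ptensor_add:
  "formal_to_ptensor (u + v) = formal_to_ptensor u + formal_to_ptensor v"
  by (simp add: formal_to_ptensor_def ptensor_abs_eqs projective_rel_refl projective_Cauchy_const)

lemma formal_to_ptensor_zero: "formal_to_ptensor 0 = 0"
  using formal_to_ptensor_diff[of 0 0] by simp

lemma formal_to_ptensor_null:
  "u - v \<in> tensor_null \<Longrightarrow> formal_to_ptensor u = formal_to_ptensor v"
  using norm_formal_to_ptensor[of "u - v"] by (simp add: projective_norm_null formal_to_ptensor_diff)

lemma formal_to_ptensor_LIMSEQ:
  assumes s: "projective_Cauchy s"
  shows "(\<lambda>n. formal_to_ptensor (s n)) \<longlonglongrightarrow> abs_ptensor s"
proof (rule LIMSEQ_I)
  fix e :: real
  assume "0 < e"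
  then have "0 < e / 2" by simp
  with s obtain N where N: "\<And>m n. m \<ge> N \<Longrightarrow> n \<ge> N \<Longrightarrow> projective_norm (s m - s n) < e / 2"
    unfolding projective_Cauchy_def by metis
  have "norm (formal_to_ptensor (s n) - abs_ptensor s) < e" if n: "n \<ge> N" for n
  proof -
    have C: "projective_Cauchy (\<lambda>m. s n - s m)"
      using projective_Cauchy_add[OF projective_Cauchy_const[of "s n"] projective_Cauchy_scale[OF s, of "-1"]]
      by (simp add: formal.scale_minus_left)
    have "formal_to_ptensor (s n) - abs_ptensor s = abs_ptensor (\<lambda>m. s n - s m)"
      using s by (simp add: formal_to_ptensor_def ptensor_abs_eqs projective_rel_refl projective_Cauchy_const)
    moreover have "norm (abs_ptensor (\<lambda>m. s n - s m)) \<le> e / 2"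
      by (rule tendsto_upperbound[OF norm_ptensor_LIMSEQ[OF C]])
        (use N[OF n] in \<open>auto simp: eventually_sequentially intro!: exI[of _ N] less_imp_le\<close>)
    ultimately show ?thesis using \<open>0 < e\<close> by simp
  qed
  then show "\<exists>N. \<forall>n\<ge>N. norm (formal_to_ptensor (s n) - abs_ptensor s) < e" by blast
qed

lemma formal_to_ptensor_dense:
  assumes "0 < e"
  obtains u where "norm (formal_to_ptensor u - x) < e"
proof -
  obtain s where s: "projective_Cauchy s" "x = abs_ptensor s" by (rule ptensor_cases)
  then show ?thesis
    using LIMSEQ_D[OF formal_to_ptensor_LIMSEQ[OF s(1)] assms] that by blast
qed

instantiation ptensor :: (complex_banach, complex_banach) complex_banach
begin

lift_definition scaleC_ptensor :: "complex \<Rightarrow> ('a, 'b) ptensor \<Rightarrow> ('a, 'b) ptensor"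
  is "\<lambda>c s n. formal_scale c (s n)"
  by (rule projective_rel_scale)

instance
proof
  fix X :: "nat \<Rightarrow> ('a, 'b) ptensor"
  assume X: "Cauchy X"
  have "\<exists>u. norm (formal_to_ptensor u - X n) < inverse (Suc n)" for n
    by (rule formal_to_ptensor_dense[of "inverse (Suc n)" "X n"]) auto
  then obtain u where u: "\<And>n. norm (formal_to_ptensor (u n) - X n) < inverse (Suc n)" by metis
  have zero: "(\<lambda>n. formal_to_ptensor (u n) - X n) \<longlonglongrightarrow> 0"
    by (rule tendsto_norm_zero_cancel, rule tendsto_zero_squeeze[OF LIMSEQ_inverse_real_of_nat])
      (use u in \<open>auto intro: less_imp_le\<close>)
  have "Cauchy (\<lambda>n. formal_to_ptensor (u n))"
  proof (rule CauchyI)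
    fix e :: real
    assume "0 < e"
    then have "0 < e / 2" by simp
    then obtain M N where M: "\<And>m n. m \<ge> M \<Longrightarrow> n \<ge> M \<Longrightarrow> norm (X m - X n) < e / 2"
      and N: "\<And>m n. m \<ge> N \<Longrightarrow> n \<ge> N \<Longrightarrow>
        norm ((formal_to_ptensor (u m) - X m) - (formal_to_ptensor (u n) - X n)) < e / 2"
      using CauchyD[OF X] CauchyD[OF LIMSEQ_imp_Cauchy[OF zero]] by metis
    show "\<exists>M. \<forall>m\<ge>M. \<forall>n\<ge>M. norm (formal_to_ptensor (u m) - formal_to_ptensor (u n)) < e"
    proof (intro exI allI impI)
      fix m n assume "max M N \<le> m" "max M N \<le> n"
      with M[of m n] N[of m n] norm_triangle_ineq[of "X m - X n"
          "(formal_to_ptensor (u m) - X m) - (formal_to_ptensor (u n) - X n)"]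
      show "norm (formal_to_ptensor (u m) - formal_to_ptensor (u n)) < e"
        by (simp add: algebra_simps)
    qed
  qed
  then have C: "projective_Cauchy u"
    by (simp add: Cauchy_iff projective_Cauchy_def norm_formal_to_ptensor flip: formal_to_ptensor_diff)
  from tendsto_diff[OF formal_to_ptensor_LIMSEQ[OF C] zero] have "X \<longlonglongrightarrow> abs_ptensor u" by simp
  then show "convergent X" by (auto simp: convergent_def)
next
  fix x y :: "('a, 'b) ptensor" and c d :: complex and r :: real
  obtain s where s: "projective_Cauchy s" "x = abs_ptensor s" by (rule ptensor_cases)
  obtain t where t: "projective_Cauchy t" "y = abs_ptensor t" by (rule ptensor_cases)
  note eqs = s t ptensor_abs_eqs scaleC_ptensor.abs_eq projective_rel_refl projective_Cauchy_add
    projective_Cauchy_scale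
  show "c *\<^sub>C (x + y) = c *\<^sub>C x + c *\<^sub>C y" "(c + d) *\<^sub>C x = c *\<^sub>C x + d *\<^sub>C x"
    "c *\<^sub>C d *\<^sub>C x = (c * d) *\<^sub>C x" "r *\<^sub>R x = complex_of_real r *\<^sub>C x"
    by (simp_all add: eqs formal.scale_right_distrib formal.scale_left_distrib)
  show "norm (c *\<^sub>C x) = cmod c * norm x"
  proof (rule LIMSEQ_unique)
    show "(\<lambda>n. projective_norm (formal_scale c (s n))) \<longlonglongrightarrow> norm (c *\<^sub>C x)"
      using norm_ptensor_LIMSEQ[OF projective_Cauchy_scale[OF s(1), of c]] by (simp add: eqs)
    show "(\<lambda>n. projective_norm (formal_scale c (s n))) \<longlonglongrightarrow> cmod c * norm x"
      using norm_ptensor_LIMSEQ[OF s(1)] by (auto simp: projective_norm_scale s intro: tendsto_mult)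
  qed
qed

end

lemma formal_to_ptensor_scale:
  "formal_to_ptensor (formal_scale c u) = c *\<^sub>C formal_to_ptensor u"
  by (simp add: formal_to_ptensor_def scaleC_ptensor.abs_eq projective_rel_refl projective_Cauchy_const)

definition elementary_tensor :: "'a::complex_banach \<Rightarrow> 'b::complex_banach \<Rightarrow> ('a, 'b) ptensor"  (infixr \<open>\<otimes>\<^sub>p\<close> 70)
  where "a \<otimes>\<^sub>p b = formal_to_ptensor (formal_single (a, b))"

lemma norm_elementary_tensor_le: "norm (a \<otimes>\<^sub>p b) \<le> norm a * norm b"
  by (simp add: elementary_tensor_def norm_formal_to_ptensor projective_norm_single)

lemma elementary_tensor_linear:
  "(a + a') \<otimes>\<^sub>p b = a \<otimes>\<^sub>p b + a' \<otimes>\<^sub>p b"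
  "a \<otimes>\<^sub>p (b + b') = a \<otimes>\<^sub>p b + a \<otimes>\<^sub>p b'"
  "(c *\<^sub>C a) \<otimes>\<^sub>p b = c *\<^sub>C (a \<otimes>\<^sub>p b)"
  "a \<otimes>\<^sub>p (c *\<^sub>C b) = c *\<^sub>C (a \<otimes>\<^sub>p b)"
proof -
  show "(a + a') \<otimes>\<^sub>p b = a \<otimes>\<^sub>p b + a' \<otimes>\<^sub>p b"
    unfolding elementary_tensor_def formal_to_ptensor_add[symmetric] diff_diff_eq[symmetric]
    by (rule formal_to_ptensor_null, unfold diff_diff_eq[symmetric], rule formal.span_base)
      (force simp: tensor_relations_def)
  show "a \<otimes>\<^sub>p (b + b') = a \<otimes>\<^sub>p b + a \<otimes>\<^sub>p b'"
    unfolding elementary_tensor_def formal_to_ptensor_add[symmetric]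
    by (rule formal_to_ptensor_null, unfold diff_diff_eq[symmetric], rule formal.span_base)
      (force simp: tensor_relations_def)
  show "(c *\<^sub>C a) \<otimes>\<^sub>p b = c *\<^sub>C (a \<otimes>\<^sub>p b)"
    unfolding elementary_tensor_def formal_to_ptensor_scale[symmetric]
    by (rule formal_to_ptensor_null, rule formal.span_base) (force simp: tensor_relations_def)
  show "a \<otimes>\<^sub>p (c *\<^sub>C b) = c *\<^sub>C (a \<otimes>\<^sub>p b)"
    unfolding elementary_tensor_def formal_to_ptensor_scale[symmetric]
    by (rule formal_to_ptensor_null, rule formal.span_base) (force simp: tensor_relations_def)
qed

lemma bounded_cbilinear_elementary_tensor: "bounded_cbilinear (\<otimes>\<^sub>p)"
  unfolding bounded_cbilinear_def
  by (auto simp: elementary_tensor_linear scaleR_scaleC norm_elementary_tensor_le intro!: exI[of _ 1] bounded_bilinear.intro)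

text \<open>The unique bounded linear map with \<open>a \<otimes> b \<mapsto> B a b\<close>.\<close>

definition ptensor_lift ::
    "('a::complex_banach \<Rightarrow> 'b::complex_banach \<Rightarrow> 'c::complex_banach) \<Rightarrow> ('a, 'b) ptensor \<Rightarrow> 'c"
  where "ptensor_lift B = (THE T. bounded_clinear T \<and> (\<forall>a b. T (a \<otimes>\<^sub>p b) = B a b))"

lemma ptensor_ext:
  fixes T S :: "('a::complex_banach, 'b::complex_banach) ptensor \<Rightarrow> 'c::complex_banach"
  assumes T: "bounded_clinear T" and S: "bounded_clinear S"
    and eq: "\<And>a b. T (a \<otimes>\<^sub>p b) = S (a \<otimes>\<^sub>p b)"
  shows "T = S"
proof
  fix x :: "('a, 'b) ptensor"
  have lin: "U (formal_to_ptensor (\<Sum>k\<in>K. formal_scale (f k) (formal_single k)))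
      = (\<Sum>k\<in>K. f k *\<^sub>C U (fst k \<otimes>\<^sub>p snd k))" if U: "bounded_clinear U" and K: "finite K"
    for U :: "('a, 'b) ptensor \<Rightarrow> 'c" and K f
    using K
  proof (induction K rule: finite_induct)
    case (insert k K)
    then show ?case
      using U by (simp add: formal_to_ptensor_add formal_to_ptensor_scale elementary_tensor_def bounded_clinear_def
          linear_simps)
  qed (simp add: formal_to_ptensor_zero bounded_clinear_eq_0[OF U])
  have formal: "T (formal_to_ptensor u) = S (formal_to_ptensor u)" for u
    using lin[OF T finite_keys[of u], of "Poly_Mapping.lookup u"]
      lin[OF S finite_keys[of u], of "Poly_Mapping.lookup u"]
    by (simp add: eq flip: formal_expansion)
  obtain s where s: "projective_Cauchy s" "x = abs_ptensor s" by (rule ptensor_cases)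
  from T S have "bounded_linear T" "bounded_linear S" by (auto simp: bounded_clinear_def)
  then have "(\<lambda>n. T (formal_to_ptensor (s n))) \<longlonglongrightarrow> T x" "(\<lambda>n. S (formal_to_ptensor (s n))) \<longlonglongrightarrow> S x"
    using formal_to_ptensor_LIMSEQ[OF s(1)] by (auto simp: s intro: bounded_linear.tendsto)
  then show "T x = S x" by (simp add: formal LIMSEQ_unique)
qed

lemma ptensor_lift_exists:
  fixes B :: "'a::complex_banach \<Rightarrow> 'b::complex_banach \<Rightarrow> 'c::complex_banach"
  assumes B: "bounded_cbilinear B"
  shows "\<exists>T. bounded_clinear T \<and> (\<forall>a b. T (a \<otimes>\<^sub>p b) = B a b)"
proof -
  from B interpret bounded_bilinear B by (simp add: bounded_cbilinear_def)
  have Bc: "B (c *\<^sub>C a) b = c *\<^sub>C B a b" "B a (c *\<^sub>C b) = c *\<^sub>C B a b" for c a b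
    using B by (auto simp: bounded_cbilinear_def)
  obtain K where K: "0 \<le> K" "\<And>a b. norm (B a b) \<le> norm a * norm b * K"
    using nonneg_bounded by blast
  define L where "L u = (\<Sum>k\<in>Poly_Mapping.keys u. Poly_Mapping.lookup u k *\<^sub>C B (fst k) (snd k))"
    for u :: "'a \<times> 'b \<Rightarrow>\<^sub>0 complex"
  have L_eq: "L u = (\<Sum>k\<in>A. Poly_Mapping.lookup u k *\<^sub>C B (fst k) (snd k))"
    if "finite A" "Poly_Mapping.keys u \<subseteq> A" for u A
    unfolding L_def by (rule sum.mono_neutral_left) (use that in \<open>auto simp: in_keys_iff\<close>)
  have L_add: "L (u + v) = L u + L v" for u v
    unfolding L_def
    by (rule setsum_keys_plus_distrib[where f = "\<lambda>k c. c *\<^sub>C B (fst k) (snd k)"])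
      (simp_all add: scaleC_add_left)
  have L_scale: "L (formal_scale c u) = c *\<^sub>C L u" for c u
  proof -
    have "L (formal_scale c u) = (\<Sum>k\<in>Poly_Mapping.keys u. (c * Poly_Mapping.lookup u k) *\<^sub>C B (fst k) (snd k))"
      by (subst L_eq[of "Poly_Mapping.keys u"]) (auto simp: in_keys_iff)
    also have "\<dots> = c *\<^sub>C L u"
      by (simp add: L_def linear_sum[OF bounded_linear.linear[OF bounded_linear_scaleC]] flip: scaleC_scaleC)
    finally show ?thesis .
  qed
  have L_diff: "L (u - v) = L u - L v" for u v
    using L_add[of "u - v" v] by simp
  have L_single: "L (formal_single (a, b)) = B a b" for a b
    by (simp add: L_def)
  have L_null: "L u = 0" if "u \<in> tensor_null" for u
    using that
  proof (induction rule: formal.span_induct_alt)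
    case base
    show ?case by (simp add: L_def)
  next
    case (step c u v)
    have "L u = 0"
      using step(1) unfolding tensor_relations_def
      by (auto simp: L_diff L_scale L_single Bc add_left add_right)
    then show ?case using step by (simp add: L_add L_scale)
  qed
  have L_list: "norm (L (\<Sum>p\<leftarrow>xs. formal_single p)) \<le> K * (\<Sum>(a, b)\<leftarrow>xs. norm a * norm b)" for xs
  proof (induction xs)
    case Nil
    show ?case by (simp add: L_def)
  next
    case (Cons p xs)
    obtain a b where p: "p = (a, b)" by force
    have "norm (L (\<Sum>p\<leftarrow>p # xs. formal_single p)) \<le> norm (B a b) + norm (L (\<Sum>p\<leftarrow>xs. formal_single p))"
      by (simp add: p L_add L_single norm_triangle_ineq)
    also have "\<dots> \<le> norm a * norm b * K + K * (\<Sum>(a, b)\<leftarrow>xs. norm a * norm b)"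
      by (intro add_mono K Cons)
    finally show ?case by (simp add: p algebra_simps)
  qed
  have L_bound: "norm (L u) \<le> K * projective_norm u" for u
  proof (rule field_le_epsilon)
    fix e :: real
    assume e: "0 < e"
    then have "projective_norm u < projective_norm u + e / (K + 1)" using K by simp
    then obtain xs where xs: "u - (\<Sum>p\<leftarrow>xs. formal_single p) \<in> tensor_null"
      "(\<Sum>(a, b)\<leftarrow>xs. norm a * norm b) < projective_norm u + e / (K + 1)"
      by (rule projective_norm_witness)
    have "L u = L (\<Sum>p\<leftarrow>xs. formal_single p)" using L_null[OF xs(1)] by (simp add: L_diff)
    then have "norm (L u) \<le> K * (\<Sum>(a, b)\<leftarrow>xs. norm a * norm b)" using L_list[of xs] by simp
    also have "\<dots> \<le> K * (projective_norm u + e / (K + 1))"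
      by (intro mult_left_mono) (use xs K in auto)
    also have "\<dots> = K * projective_norm u + e * (K / (K + 1))" by (simp add: algebra_simps)
    also have "\<dots> \<le> K * projective_norm u + e * 1"
      by (intro add_left_mono mult_left_mono) (use e K in auto)
    finally show "norm (L u) \<le> K * projective_norm u + e" by simp
  qed
  have conv: "convergent (\<lambda>n. L (s n))" if s: "projective_Cauchy s" for s
  proof -
    have "Cauchy (\<lambda>n. L (s n))"
    proof (rule CauchyI)
      fix e :: real
      assume "0 < e"
      then have "0 < e / (K + 1)" using K by simp
      with s obtain N where N: "\<And>m n. m \<ge> N \<Longrightarrow> n \<ge> N \<Longrightarrow> projective_norm (s m - s n) < e / (K + 1)"
        unfolding projective_Cauchy_def by metis
      show "\<exists>N. \<forall>m\<ge>N. \<forall>n\<ge>N. norm (L (s m) - L (s n)) < e"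
      proof (intro exI allI impI)
        fix m n assume mn: "N \<le> m" "N \<le> n"
        have "norm (L (s m) - L (s n)) \<le> K * projective_norm (s m - s n)"
          by (simp add: L_bound flip: L_diff)
        also have "\<dots> \<le> (K + 1) * projective_norm (s m - s n)"
          by (intro mult_right_mono projective_norm_nonneg) auto
        also have "\<dots> < e" using N[OF mn] K by (simp add: field_simps)
        finally show "norm (L (s m) - L (s n)) < e" .
      qed
    qed
    then show ?thesis by (simp add: Cauchy_convergent_iff)
  qed
  define T where "T x = lim (\<lambda>n. L (rep_ptensor x n))" for x
  have T: "(\<lambda>n. L (s n)) \<longlonglongrightarrow> T (abs_ptensor s)" if s: "projective_Cauchy s" for s
  proof -
    define t where "t = rep_ptensor (abs_ptensor s)"
    have st: "projective_rel t s"
      using s unfolding t_def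
      by (intro Quotient_rep_abs[OF Quotient_ptensor]) (simp add: projective_rel_refl)
    then have t: "(\<lambda>n. L (t n)) \<longlonglongrightarrow> T (abs_ptensor s)"
      unfolding T_def t_def[symmetric] by (simp add: conv projective_rel_def flip: convergent_LIMSEQ_iff)
    have "(\<lambda>n. L (s n) - L (t n)) \<longlonglongrightarrow> 0"
    proof (rule tendsto_norm_zero_cancel, rule tendsto_zero_squeeze)
      show "(\<lambda>n. K * projective_norm (t n - s n)) \<longlonglongrightarrow> 0"
        using st unfolding projective_rel_def by (auto intro: tendsto_mult_right_zero)
      show "norm (L (s n) - L (t n)) \<le> K * projective_norm (t n - s n)" for n
        using L_bound[of "s n - t n"] projective_norm_diff_commute[of "s n" "t n"] by (simp add: L_diff)
    qed simp
    from tendsto_add[OF this t] show ?thesis by simp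
  qed
  have "bounded_clinear T"
  proof (rule bounded_clinearI[where K = K])
    fix x y :: "('a, 'b) ptensor" and c
    obtain s where s: "projective_Cauchy s" "x = abs_ptensor s" by (rule ptensor_cases)
    obtain t where t: "projective_Cauchy t" "y = abs_ptensor t" by (rule ptensor_cases)
    have "(\<lambda>n. L (s n + t n)) \<longlonglongrightarrow> T (x + y)"
      using T[OF projective_Cauchy_add[OF s(1) t(1)]] s t
      by (simp add: plus_ptensor.abs_eq projective_rel_refl)
    moreover have "(\<lambda>n. L (s n + t n)) \<longlonglongrightarrow> T x + T y"
      unfolding L_add s t by (intro tendsto_add T s t)
    ultimately show "T (x + y) = T x + T y" by (rule LIMSEQ_unique)
    have "(\<lambda>n. L (formal_scale c (s n))) \<longlonglongrightarrow> T (c *\<^sub>C x)"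
      using T[OF projective_Cauchy_scale[OF s(1), of c]] s
      by (simp add: scaleC_ptensor.abs_eq projective_rel_refl)
    moreover have "(\<lambda>n. L (formal_scale c (s n))) \<longlonglongrightarrow> c *\<^sub>C T x"
      unfolding L_scale s by (intro bounded_linear.tendsto[OF bounded_linear_scaleC] T s)
    ultimately show "T (c *\<^sub>C x) = c *\<^sub>C T x" by (rule LIMSEQ_unique)
    have "(\<lambda>n. norm (L (s n))) \<longlonglongrightarrow> norm (T x)"
      unfolding s by (intro tendsto_norm T s)
    moreover have "(\<lambda>n. K * projective_norm (s n)) \<longlonglongrightarrow> K * norm x"
      unfolding s by (intro tendsto_mult tendsto_const norm_ptensor_LIMSEQ s)
    ultimately have "norm (T x) \<le> K * norm x"
      by (rule LIMSEQ_le) (use L_bound in blast)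
    then show "norm (T x) \<le> norm x * K" by (simp add: mult.commute)
  qed
  moreover have "T (a \<otimes>\<^sub>p b) = B a b" for a b
    using T[OF projective_Cauchy_const[of "formal_single (a, b)"]]
    by (simp add: elementary_tensor_def formal_to_ptensor_def L_single LIMSEQ_const_iff)
  ultimately show ?thesis by blast
qed

lemma ptensor_lift:
  assumes "bounded_cbilinear B"
  shows bounded_clinear_ptensor_lift: "bounded_clinear (ptensor_lift B)"
    and ptensor_lift_elementary_tensor: "ptensor_lift B (a \<otimes>\<^sub>p b) = B a b"
proof -
  have "\<exists>!T. bounded_clinear T \<and> (\<forall>a b. T (a \<otimes>\<^sub>p b) = B a b)"
    using ptensor_lift_exists[OF assms] by (auto intro!: ptensor_ext)
  from theI'[OF this] show "bounded_clinear (ptensor_lift B)" "ptensor_lift B (a \<otimes>\<^sub>p b) = B a b"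
    by (auto simp: ptensor_lift_def)
qed


section \<open>Strong pseudo-amenability\<close>

definition ptensor_left ::
    "'a::complex_banach_algebra \<Rightarrow> ('a, 'a) ptensor \<Rightarrow> ('a, 'a) ptensor"
  where "ptensor_left a = ptensor_lift (\<lambda>b c. (a * b) \<otimes>\<^sub>p c)"

definition ptensor_right ::
    "('a, 'a) ptensor \<Rightarrow> 'a::complex_banach_algebra \<Rightarrow> ('a, 'a) ptensor"
  where "ptensor_right x a = ptensor_lift (\<lambda>b c. b \<otimes>\<^sub>p (c * a)) x"

definition product_map :: "('a, 'a) ptensor \<Rightarrow> 'a::complex_banach_algebra"
  where "product_map = ptensor_lift (*)"

lemma bounded_cbilinear_comp:
  assumes "bounded_cbilinear f" "bounded_clinear g" "bounded_clinear h"
  shows "bounded_cbilinear (\<lambda>x y. f (g x) (h y))"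
  using assms by (auto simp: bounded_cbilinear_def bounded_clinear_def intro: bounded_bilinear.comp)

lemma bounded_clinear_id: "bounded_clinear (\<lambda>x. x)"
  by (simp add: bounded_clinear_def bounded_linear_ident)

lemma ptensor_left:
  shows bounded_clinear_ptensor_left: "bounded_clinear (ptensor_left a)"
    and ptensor_left_elementary_tensor: "ptensor_left a (b \<otimes>\<^sub>p c) = (a * b) \<otimes>\<^sub>p c"
proof -
  note * = bounded_cbilinear_comp[OF bounded_cbilinear_elementary_tensor bounded_clinear_mult_left bounded_clinear_id]
  show "bounded_clinear (ptensor_left a)" "ptensor_left a (b \<otimes>\<^sub>p c) = (a * b) \<otimes>\<^sub>p c"
    unfolding ptensor_left_def by (rule ptensor_lift[OF *])+
qed

lemma ptensor_right:
  shows bounded_clinear_ptensor_right: "bounded_clinear (\<lambda>x. ptensor_right x a)"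
    and ptensor_right_elementary_tensor: "ptensor_right (b \<otimes>\<^sub>p c) a = b \<otimes>\<^sub>p (c * a)"
proof -
  note * = bounded_cbilinear_comp[OF bounded_cbilinear_elementary_tensor bounded_clinear_id bounded_clinear_mult_right]
  show "bounded_clinear (\<lambda>x. ptensor_right x a)" "ptensor_right (b \<otimes>\<^sub>p c) a = b \<otimes>\<^sub>p (c * a)"
    unfolding ptensor_right_def by (rule ptensor_lift[OF *])+
qed

lemma product_map:
  shows bounded_clinear_product_map: "bounded_clinear product_map"
    and product_map_elementary_tensor: "product_map (b \<otimes>\<^sub>p c) = b * c"
  unfolding product_map_def by (rule ptensor_lift[OF bounded_cbilinear_mult])+

definition directed_set :: "'i set \<Rightarrow> ('i \<Rightarrow> 'i \<Rightarrow> bool) \<Rightarrow> bool"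
  where "directed_set D le \<longleftrightarrow> D \<noteq> {} \<and> (\<forall>i\<in>D. le i i) \<and>
    (\<forall>i\<in>D. \<forall>j\<in>D. \<forall>k\<in>D. le i j \<longrightarrow> le j k \<longrightarrow> le i k) \<and>
    (\<forall>i\<in>D. \<forall>j\<in>D. \<exists>k\<in>D. le i k \<and> le j k)"

definition net_filter :: "'i set \<Rightarrow> ('i \<Rightarrow> 'i \<Rightarrow> bool) \<Rightarrow> 'i filter"
  where "net_filter D le = (INF i\<in>D. principal {j \<in> D. le i j})"

lemma eventually_net_filter:
  assumes "directed_set D le"
  shows "eventually P (net_filter D le) \<longleftrightarrow> (\<exists>i\<in>D. \<forall>j\<in>D. le i j \<longrightarrow> P j)"
proof -
  have "eventually P (net_filter D le) \<longleftrightarrow> (\<exists>i\<in>D. eventually P (principal {j \<in> D. le i j}))"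
    unfolding net_filter_def
  proof (rule eventually_INF_base)
    show "D \<noteq> {}" using assms by (simp add: directed_set_def)
    fix i j assume ij: "i \<in> D" "j \<in> D"
    then obtain k where k: "k \<in> D" "le i k" "le j k"
      using assms unfolding directed_set_def by metis
    have "{l \<in> D. le k l} \<subseteq> {l \<in> D. le i l} \<inter> {l \<in> D. le j l}"
      using assms ij k unfolding directed_set_def by blast
    then show "\<exists>x\<in>D. principal {j \<in> D. le x j} \<le> inf (principal {j \<in> D. le i j}) (principal {l \<in> D. le j l})"
      using k by (intro bexI[of _ k]) simp_all
  qed
  then show ?thesis by (auto simp: eventually_principal)
qed

definition strong_pseudo_amenable_net ::
    "'i set \<Rightarrow> ('i \<Rightarrow> 'i \<Rightarrow> bool) \<Rightarrow>
      ('i \<Rightarrow> ('a::complex_banach_algebra, 'a) ptensor cdual cdual) \<Rightarrow> bool"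
  where "strong_pseudo_amenable_net D le m \<longleftrightarrow> directed_set D le \<and>
    (let \<pi> = dual_map (dual_map product_map) in \<forall>a.
      ((\<lambda>i. bidual_left ptensor_left a (m i) - bidual_right ptensor_right (m i) a) \<longlongrightarrow> 0)
        (net_filter D le) \<and>
      (\<forall>i\<in>D. bidual_left (*) a (\<pi> (m i)) = bidual_right (*) (\<pi> (m i)) a) \<and>
      ((\<lambda>i. bidual_right (*) (\<pi> (m i)) a) \<longlongrightarrow> canonical_embedding a) (net_filter D le))"

text \<open>
  A definition cannot quantify over the index type of a net.  The type \<open>'a set \<times> nat\<close> used below is
  large enough: by \<open>strong_pseudo_amenableI\<close>, a net over any index type may be replaced by one over it.
\<close>

definition strong_pseudo_amenable :: "'a::complex_banach_algebra itself \<Rightarrow> bool"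
  where "strong_pseudo_amenable _ \<longleftrightarrow>
    (\<exists>(D :: ('a set \<times> nat) set) le (m :: _ \<Rightarrow> ('a, 'a) ptensor cdual cdual).
      strong_pseudo_amenable_net D le m)"

lemma strong_pseudo_amenableI:
  fixes m :: "'i \<Rightarrow> ('a::complex_banach_algebra, 'a) ptensor cdual cdual"
  assumes net: "strong_pseudo_amenable_net D le m"
  shows "strong_pseudo_amenable TYPE('a)"
proof -
  let ?\<pi> = "dual_map (dual_map (product_map :: ('a, 'a) ptensor \<Rightarrow> 'a))"
  define f where "f a M = bidual_left ptensor_left a M - bidual_right ptensor_right M a"
    for a and M :: "('a, 'a) ptensor cdual cdual"
  define g where "g a M = bidual_right (*) (?\<pi> M) a" for a M
  have D: "directed_set D le"
    and f: "((\<lambda>i. f a (m i)) \<longlongrightarrow> 0) (net_filter D le)"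
    and c: "i \<in> D \<Longrightarrow> bidual_left (*) a (?\<pi> (m i)) = g a (m i)"
    and g: "((\<lambda>i. g a (m i)) \<longlongrightarrow> canonical_embedding a) (net_filter D le)" for a i
    using net unfolding strong_pseudo_amenable_net_def Let_def f_def g_def by blast+
  let ?D = "{p :: 'a set \<times> nat. finite (fst p)}"
  let ?le = "\<lambda>p q :: 'a set \<times> nat. fst p \<subseteq> fst q \<and> snd p \<le> snd q"
  have D': "directed_set ?D ?le"
    unfolding directed_set_def
  proof (intro conjI ballI impI)
    have "({}, 0) \<in> ?D" by simp
    then show "?D \<noteq> {}" by blast
  next
    fix p q assume "p \<in> ?D" "q \<in> ?D"
    then show "\<exists>r\<in>?D. ?le p r \<and> ?le q r"
      by (intro bexI[of _ "(fst p \<union> fst q, max (snd p) (snd q))"]) auto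
  qed auto
  have "\<exists>i\<in>D. \<forall>a\<in>fst p. dist (f a (m i)) 0 < inverse (Suc (snd p)) \<and>
      dist (g a (m i)) (canonical_embedding a) < inverse (Suc (snd p))" (is "\<exists>i\<in>D. ?Q p i")
    if "p \<in> ?D" for p
  proof -
    have "eventually (?Q p) (net_filter D le)"
    proof (rule eventually_ball_finite)
      show "finite (fst p)" using that by simp
      show "\<forall>a\<in>fst p. \<forall>\<^sub>F i in net_filter D le. dist (f a (m i)) 0 < inverse (Suc (snd p)) \<and>
          dist (g a (m i)) (canonical_embedding a) < inverse (Suc (snd p))"
        by (intro ballI eventually_conj tendstoD[OF f] tendstoD[OF g]) simp_all
    qed
    then obtain i where "i \<in> D" "\<forall>j\<in>D. le i j \<longrightarrow> ?Q p j"
      unfolding eventually_net_filter[OF D] ..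
    moreover have "le i i" using D \<open>i \<in> D\<close> by (simp add: directed_set_def)
    ultimately show ?thesis by blast
  qed
  then have "\<forall>p\<in>?D. \<exists>i. i \<in> D \<and> ?Q p i" by blast
  then obtain h where "\<forall>p\<in>?D. h p \<in> D \<and> ?Q p (h p)" by (rule bchoice[THEN exE])
  then have h: "\<And>p. p \<in> ?D \<Longrightarrow> h p \<in> D"
    and hf: "\<And>p a. p \<in> ?D \<Longrightarrow> a \<in> fst p \<Longrightarrow> dist (f a (m (h p))) 0 < inverse (Suc (snd p))"
    and hg: "\<And>p a. p \<in> ?D \<Longrightarrow> a \<in> fst p \<Longrightarrow>
      dist (g a (m (h p))) (canonical_embedding a) < inverse (Suc (snd p))"
    by blast+
  have lim: "(F \<longlongrightarrow> l) (net_filter ?D ?le)"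
    if F: "\<And>p. p \<in> ?D \<Longrightarrow> a \<in> fst p \<Longrightarrow> dist (F p) l < inverse (Suc (snd p))"
    for F :: "_ \<Rightarrow> 'z::metric_space" and l and a :: 'a
  proof (rule tendstoI)
    fix e :: real
    assume "0 < e"
    then obtain n where n: "inverse (Suc n) < e" using reals_Archimedean by blast
    show "\<forall>\<^sub>F p in net_filter ?D ?le. dist (F p) l < e"
      unfolding eventually_net_filter[OF D']
    proof (rule bexI[of _ "({a}, n)"], intro ballI impI)
      fix p assume p: "p \<in> ?D" "?le ({a}, n) p"
      then have "inverse (real (Suc (snd p))) \<le> inverse (real (Suc n))" by (simp add: field_simps)
      moreover have "dist (F p) l < inverse (real (Suc (snd p)))" using F p by auto
      ultimately show "dist (F p) l < e" using n by linarith
    qed simp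
  qed
  have "strong_pseudo_amenable_net ?D ?le (\<lambda>p. m (h p))"
    unfolding strong_pseudo_amenable_net_def Let_def f_def[symmetric] g_def[symmetric]
    using D' h c by (auto intro!: lim[OF hf] lim[OF hg])
  then show ?thesis unfolding strong_pseudo_amenable_def by blast
qed


end

theory Submission
  imports Defs
begin

text \<open>
  Let \<open>A\<close> be the algebra of \<open>\<ell>\<^sup>1\<close> matrices.  The restriction \<open>w\<close> to \<open>A\<^sup>*\<close> of an element of \<open>A\<^sup>*\<^sup>*\<^sup>*\<^sup>*\<close>
  that commutes with the matrix units has a matrix \<open>w (e\<^sub>i\<^sub>j\<^sup>*)\<close> which is a scalar multiple \<open>c\<close> of the
  identity.  Partial traces are functionals of norm at most one, so \<open>n \<bar>c\<bar> \<le> \<parallel>w\<parallel>\<close> for all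
  \<open>n \<le> |I|\<close>, and \<open>c = 0\<close> when \<open>I\<close> is infinite.  But \<open>c\<close> is also the \<open>(i, i)\<close> entry of \<open>w \<cdot> e\<^sub>i\<^sub>i\<close>, so
  elements of this kind cannot act as an approximate identity.  When \<open>I\<close> is finite with \<open>n\<close>
  elements, \<open>A\<^sup>*\<^sup>*\<close> is spanned by the matrix units, and the constant net with value
  \<open>n\<^sup>-\<^sup>1 \<Sum> e\<^sub>i\<^sub>j \<otimes> e\<^sub>j\<^sub>i\<close> works.
\<close>

section \<open>Finite sums under bounded linear maps and tensors\<close>

lemma bounded_clinear_sum:
  assumes "bounded_clinear f"
  shows "f (\<Sum>x\<in>S. g x) = (\<Sum>x\<in>S. f (g x))"
  using assms unfolding bounded_clinear_def by (auto intro: linear_sum bounded_linear.linear)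

lemma bounded_clinear_scaleC: "bounded_clinear f \<Longrightarrow> f (c *\<^sub>C x) = c *\<^sub>C f x"
  by (simp add: bounded_clinear_def)

lemma cdual_apply_sum: "cdual_apply (\<Sum>x\<in>S. g x) a = (\<Sum>x\<in>S. cdual_apply (g x) a)"
  by (induction S rule: infinite_finite_induct) auto

lemma cdual_apply_sum_right: "cdual_apply f (\<Sum>x\<in>S. g x) = (\<Sum>x\<in>S. cdual_apply f (g x))"
  by (rule bounded_clinear_sum[OF bounded_clinear_cdual_apply])

lemma scaleC_sum_left: "(\<Sum>x\<in>S. c x) *\<^sub>C y = (\<Sum>x\<in>S. c x *\<^sub>C (y :: 'a :: complex_banach))"
  by (induction S rule: infinite_finite_induct) (auto simp: scaleC_add_left)

lemma scaleC_sum_right: "c *\<^sub>C (\<Sum>x\<in>S. g x) = (\<Sum>x\<in>S. c *\<^sub>C (g x :: 'a :: complex_banach))"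
  by (induction S rule: infinite_finite_induct) (auto simp: scaleC_add_right)

lemma elementary_tensor_sum_left: "(\<Sum>x\<in>S. g x) \<otimes>\<^sub>p b = (\<Sum>x\<in>S. g x \<otimes>\<^sub>p b)"
  using bounded_cbilinear_elementary_tensor unfolding bounded_cbilinear_def
  by (blast intro: bounded_bilinear.sum_left)

lemma elementary_tensor_sum_right: "a \<otimes>\<^sub>p (\<Sum>x\<in>S. g x) = (\<Sum>x\<in>S. a \<otimes>\<^sub>p g x)"
  using bounded_cbilinear_elementary_tensor unfolding bounded_cbilinear_def
  by (blast intro: bounded_bilinear.sum_right)


section \<open>Canonical embeddings\<close>

text \<open>Naturality of the canonical embedding: the second adjoint extends \<open>T\<close>. The
  bidual actions are second adjoints too, so conditions on an embedded element become identities in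
  the original space.\<close>

lemma dual_map_dual_map_canonical_embedding:
  assumes "bounded_clinear T"
  shows "dual_map (dual_map T) (canonical_embedding x) = canonical_embedding (T x)"
  by (rule cdual_eqI)
    (simp add: dual_map_apply bounded_clinear_dual_map assms canonical_embedding.rep_eq)

lemma bidual_left_canonical_embedding:
  assumes "\<And>a. bounded_clinear (L a)"
  shows "bidual_left L a (canonical_embedding x) = canonical_embedding (L a x)"
  unfolding dual_left_def dual_right_def by (rule dual_map_dual_map_canonical_embedding[OF assms])

lemma bidual_right_canonical_embedding:
  assumes "\<And>a. bounded_clinear (\<lambda>x. R x a)"
  shows "bidual_right R (canonical_embedding x) a = canonical_embedding (R x a)"
  unfolding dual_left_def dual_right_def by (rule dual_map_dual_map_canonical_embedding[OF assms])

text \<open>Targets the type copy \<open>bidual\<close>, since that type carries the Arens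
  product.\<close>

definition bidual_of :: "'a::complex_banach \<Rightarrow> 'a bidual"
  where "bidual_of a = Bidual (canonical_embedding a)"

lemma bidual_of_apply [simp]: "cdual_apply (bidual_functional (bidual_of a)) f = cdual_apply f a"
  by (simp add: bidual_of_def Bidual_inverse canonical_embedding.rep_eq)

lemma bidual_eqI:
  "(\<And>f. cdual_apply (bidual_functional F) f = cdual_apply (bidual_functional G) f) \<Longrightarrow> F = G"
  by (metis bidual_functional_inject cdual_eqI)

lemma bidual_of_0 [simp]: "bidual_of 0 = 0"
  by (rule bidual_eqI)
    (simp add: zero_bidual.rep_eq bounded_clinear_eq_0[OF bounded_clinear_cdual_apply])

lemma bidual_of_mult: "bidual_of (a * b) = bidual_of a * bidual_of b"
  by (rule bidual_eqI) (simp add: times_bidual.rep_eq first_arens_apply arens_act_apply)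

text \<open>The canonical map from the dual into the third dual. Composing with it restricts an
  element of the fourth dual to the dual.\<close>

lift_definition dual_embedding :: "'a::complex_banach cdual \<Rightarrow> 'a bidual cdual"
  is "\<lambda>f F. cdual_apply (bidual_functional F) f"
proof -
  fix f :: "'a cdual"
  show "bounded_clinear (\<lambda>F. cdual_apply (bidual_functional F) f)"
    by (rule bounded_clinearI[where K = "norm f"])
      (auto simp: scaleC_complex_def norm_cdual_apply plus_bidual.rep_eq scaleC_bidual.rep_eq
        norm_bidual.rep_eq)
qed

lemma norm_dual_embedding: "norm (dual_embedding f) \<le> norm f"
  by (rule norm_cdual_bound)
    (auto simp: dual_embedding.rep_eq norm_bidual.rep_eq mult.commute[of "norm f"] norm_cdual_apply)

lemma dual_embedding_sum: "dual_embedding (\<Sum>x\<in>S. f x) = (\<Sum>x\<in>S. dual_embedding (f x))"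
  by (rule cdual_eqI) (simp add: dual_embedding.rep_eq cdual_apply_sum cdual_apply_sum_right)

lemma dual_embedding_0 [simp]: "dual_embedding 0 = 0"
  using dual_embedding_sum[of _ "{}"] by simp

section \<open>Actions of embedded algebra elements on the embedded dual\<close>

lemma dual_left_mult_apply [simp]:
  "cdual_apply (dual_left (*) a f) b = cdual_apply f (b * a)" for a :: "'a::complex_banach_algebra"
  by (simp add: dual_left_def dual_map_apply bounded_clinear_mult_right)

text \<open>The first Arens product \<open>G * F\<close> is weak-* continuous in \<open>F\<close>
  when \<open>G\<close> comes from the algebra, so this action keeps the embedded dual
  invariant.\<close>

lemma dual_right_dual_embedding:
  "dual_right (*) (dual_embedding f) (bidual_of a) = dual_embedding (dual_right (*) f a)"
  by (rule cdual_eqI)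
    (simp add: dual_embedding.rep_eq times_bidual.rep_eq first_arens_apply arens_act_apply)

lemma dual_left_dual_embedding:
  "dual_left (*) (bidual_of a) (dual_embedding f) = dual_embedding (dual_left (*) a f)"
proof (rule cdual_eqI)
  fix F
  have "arens_act (bidual_functional (bidual_of a)) f = dual_left (*) a f"
    by (rule cdual_eqI) (simp add: arens_act_apply)
  then show "cdual_apply (dual_left (*) (bidual_of a) (dual_embedding f)) F
      = cdual_apply (dual_embedding (dual_left (*) a f)) F"
    by (simp add: dual_embedding.rep_eq times_bidual.rep_eq first_arens_apply)
qed

lemma bounded_clinear_dual_right_mult:
  "bounded_clinear (\<lambda>f. dual_right (*) f (a :: 'a::complex_banach_algebra))"
  unfolding dual_right_def by (intro bounded_clinear_dual_map bounded_clinear_mult_left)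

lemma bounded_clinear_dual_left_mult:
  "bounded_clinear (dual_left (*) (a :: 'a::complex_banach_algebra))"
  unfolding dual_left_def by (intro bounded_clinear_dual_map bounded_clinear_mult_right)

lemma bidual_left_mult_dual_embedding:
  "cdual_apply (bidual_left (*) (bidual_of a) z) (dual_embedding f)
    = cdual_apply z (dual_embedding (dual_right (*) f a))"
  by (subst dual_left_def)
    (simp add: dual_map_apply bounded_clinear_dual_right_mult dual_right_dual_embedding)

lemma bidual_right_mult_dual_embedding:
  "cdual_apply (bidual_right (*) z (bidual_of a)) (dual_embedding f)
    = cdual_apply z (dual_embedding (dual_left (*) a f))"
  by (subst dual_right_def)
    (simp add: dual_map_apply bounded_clinear_dual_left_mult dual_left_dual_embedding)


section \<open>Matrix units\<close>

lift_definition matrix_unit :: "'i \<Rightarrow> 'i \<Rightarrow> 'i l1_matrix"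
  is "\<lambda>k l i j. if i = k \<and> j = l then 1 else 0"
proof -
  fix k l :: 'i
  have "(\<lambda>(i, j). cmod (if i = k \<and> j = l then 1 else 0)) summable_on {(k, l)}"
    by simp
  also have "?this \<longleftrightarrow> (\<lambda>(i, j). cmod (if i = k \<and> j = l then 1 else 0)) summable_on UNIV"
    by (rule summable_on_cong_neutral) (auto split: if_splits)
  finally show "(\<lambda>(i, j). cmod (if i = k \<and> j = l then 1 else 0)) summable_on UNIV" .
qed

lemma infsum_eq_single:
  assumes "\<And>x. x \<noteq> k \<Longrightarrow> f x = 0"
  shows "infsum f UNIV = (f k :: complex)"
proof -
  have "infsum f UNIV = infsum f {k}"
    by (rule infsum_cong_neutral) (use assms in auto)
  then show ?thesis by simp
qed

text \<open>Only the summand at \<open>l\<close> survives: left multiplication by a matrix unit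
  moves row \<open>l\<close> to row \<open>k\<close>.\<close>

lemma entry_matrix_unit_mult:
  "entry (matrix_unit k l * a) i j = (if i = k then entry a l j else 0)"
  by (simp add: times_l1_matrix.rep_eq matrix_unit.rep_eq infsum_eq_single[of l])

lemma entry_mult_matrix_unit:
  "entry (a * matrix_unit k l) i j = (if j = l then entry a i k else 0)"
  by (simp add: times_l1_matrix.rep_eq matrix_unit.rep_eq infsum_eq_single[of k])

lemma matrix_unit_mult:
  "matrix_unit i j * matrix_unit k l = (if j = k then matrix_unit i l else 0)"
  by (rule l1_matrix_eqI)
    (auto simp: entry_matrix_unit_mult matrix_unit.rep_eq zero_l1_matrix.rep_eq)

lift_definition entry_functional :: "'i \<Rightarrow> 'i \<Rightarrow> 'i l1_matrix cdual" is "\<lambda>i j a. entry a i j"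
proof -
  fix i j :: 'i
  show "bounded_clinear (\<lambda>a. entry a i j)"
    by (rule bounded_clinearI[where K = 1])
      (auto simp: scaleC_complex_def norm_entry_le plus_l1_matrix.rep_eq scaleC_l1_matrix.rep_eq)
qed

lemma dual_right_entry_functional:
  "dual_right (*) (entry_functional i j) (matrix_unit k l) = (if i = k then entry_functional l j else 0)"
  by (rule cdual_eqI) (simp add: entry_functional.rep_eq entry_matrix_unit_mult)

lemma dual_left_entry_functional:
  "dual_left (*) (matrix_unit k l) (entry_functional i j) = (if j = l then entry_functional i k else 0)"
  by (rule cdual_eqI) (simp add: entry_functional.rep_eq entry_mult_matrix_unit)

text \<open>Diagonal entries are among the summands of the l^1 norm, so the bound is independent of
  the size of \<open>F\<close>.\<close>

lemma norm_partial_trace: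
  assumes "finite F"
  shows "norm (\<Sum>i\<in>F. entry_functional i i) \<le> 1"
proof (rule norm_cdual_bound)
  fix a :: "'a l1_matrix"
  have "cmod (cdual_apply (\<Sum>i\<in>F. entry_functional i i) a) \<le> (\<Sum>i\<in>F. cmod (entry a i i))"
    by (simp add: cdual_apply_sum entry_functional.rep_eq norm_sum)
  also have "\<dots> = (\<Sum>(i, j)\<in>(\<lambda>i. (i, i)) ` F. cmod (entry a i j))"
    by (subst sum.reindex) (auto simp: inj_on_def)
  also have "\<dots> \<le> norm a"
    unfolding norm_l1_matrix.rep_eq
    by (rule finite_sum_le_infsum) (use assms entry_summable in auto)
  finally show "cmod (cdual_apply (\<Sum>i\<in>F. entry_functional i i) a) \<le> 1 * norm a" by simp
qed simp


section \<open>The infinite case\<close>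

text \<open>Centrality makes all diagonal values equal. A nonzero common value would add up along
  partial traces beyond the bound \<open>norm z\<close>.\<close>

lemma central_diagonal_entry_eq_0:
  fixes z :: "'i l1_matrix bidual cdual cdual"
  assumes inf: "infinite (UNIV :: 'i set)"
    and central: "\<And>a. bidual_left (*) a z = bidual_right (*) z a"
  shows "cdual_apply z (dual_embedding (entry_functional i i)) = 0"
proof (rule ccontr)
  define w where "w i j = cdual_apply z (dual_embedding (entry_functional i j))" for i j
  assume "cdual_apply z (dual_embedding (entry_functional i i)) \<noteq> 0"
  then have pos: "0 < cmod (w i i)" by (simp add: w_def)
  have diag: "w j j = w i i" for j
  proof -
    \<comment> \<open>Testing both actions of \<open>e_ij\<close> on its coordinate functional
      yields \<open>w j j\<close> on the left and \<open>w i i\<close> on the right.\<close>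
    have "cdual_apply (bidual_left (*) (bidual_of (matrix_unit i j)) z)
          (dual_embedding (entry_functional i j))
        = cdual_apply (bidual_right (*) z (bidual_of (matrix_unit i j)))
          (dual_embedding (entry_functional i j))"
      by (simp only: central)
    then show ?thesis
      unfolding bidual_left_mult_dual_embedding bidual_right_mult_dual_embedding
      by (simp add: dual_right_entry_functional dual_left_entry_functional w_def)
  qed
  obtain n where n: "norm z < real n * cmod (w i i)"
    using reals_Archimedean3[OF pos] by blast
  obtain F :: "'i set" where F: "finite F" "card F = n"
    using infinite_arbitrarily_large[OF inf] by blast
  let ?t = "dual_embedding (\<Sum>i\<in>F. entry_functional i i)"
  have "cdual_apply z ?t = (\<Sum>j\<in>F. w j j)"
    by (simp add: dual_embedding_sum cdual_apply_sum_right w_def)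
  also have "\<dots> = (\<Sum>j\<in>F. w i i)"
    by (rule sum.cong[OF refl diag])
  also have "\<dots> = of_nat n * w i i"
    using F by simp
  finally have "cdual_apply z ?t = of_nat n * w i i" .
  then have "real n * cmod (w i i) = cmod (cdual_apply z ?t)"
    by (simp add: norm_mult)
  also have "\<dots> \<le> norm z * norm ?t" by (rule norm_cdual_apply)
  also have "\<dots> \<le> norm z * 1"
    by (intro mult_left_mono order_trans[OF norm_dual_embedding norm_partial_trace] F) auto
  finally show False using n by simp
qed

lemma not_strong_pseudo_amenable:
  assumes inf: "infinite (UNIV :: 'i set)"
  shows "\<not> strong_pseudo_amenable TYPE('i l1_matrix bidual)"
proof
  let ?\<pi> = "dual_map (dual_map (product_map :: _ \<Rightarrow> 'i l1_matrix bidual))"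
  assume "strong_pseudo_amenable TYPE('i l1_matrix bidual)"
  then obtain D :: "('i l1_matrix bidual set \<times> nat) set" and le
    and m :: "_ \<Rightarrow> ('i l1_matrix bidual, 'i l1_matrix bidual) ptensor cdual cdual"
    where D: "directed_set D le"
      and central: "\<And>a i. i \<in> D \<Longrightarrow> bidual_left (*) a (?\<pi> (m i)) = bidual_right (*) (?\<pi> (m i)) a"
      and lim: "\<And>a. ((\<lambda>i. bidual_right (*) (?\<pi> (m i)) a) \<longlongrightarrow> canonical_embedding a) (net_filter D le)"
    unfolding strong_pseudo_amenable_def strong_pseudo_amenable_net_def Let_def by blast
  fix k :: 'i
  let ?e = "bidual_of (matrix_unit k k)" and ?f = "dual_embedding (entry_functional k k)"
  \<comment> \<open>An error below \<open>r\<close> in norm changes the value at \<open>?f\<close>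
    by less than 1; the added 1 makes the denominator positive.\<close>
  define r where "r = inverse (norm ?f + 1)"
  have r: "0 < r" "r * norm ?f < 1"
    using norm_ge_zero[of ?f] by (simp_all add: r_def field_simps del: norm_ge_zero)
  obtain i where i: "i \<in> D"
    and close: "\<And>j. j \<in> D \<Longrightarrow> le i j \<Longrightarrow>
      dist (bidual_right (*) (?\<pi> (m j)) ?e) (canonical_embedding ?e) < r"
    using tendstoD[OF lim r(1)] unfolding eventually_net_filter[OF D] by metis
  have "le i i" using D i unfolding directed_set_def by metis
  with i have close: "norm (bidual_right (*) (?\<pi> (m i)) ?e - canonical_embedding ?e) < r"
    unfolding dist_norm[symmetric] by (rule close)
  \<comment> \<open>Acting by \<open>e_kk\<close> preserves the \<open>(k, k)\<close> value, which
    vanishes by centrality, whereas \<open>e_kk\<close> itself has value 1 there.\<close>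
  have "cdual_apply (bidual_right (*) (?\<pi> (m i)) ?e) ?f = 0"
    using central_diagonal_entry_eq_0[OF inf central[OF i]]
    by (simp add: bidual_right_mult_dual_embedding dual_left_entry_functional)
  moreover have "cdual_apply (canonical_embedding ?e) ?f = 1"
    by (simp add: canonical_embedding.rep_eq dual_embedding.rep_eq entry_functional.rep_eq
        matrix_unit.rep_eq)
  ultimately have "1 \<le> norm (bidual_right (*) (?\<pi> (m i)) ?e - canonical_embedding ?e) * norm ?f"
    using norm_cdual_apply[of "bidual_right (*) (?\<pi> (m i)) ?e - canonical_embedding ?e" ?f] by simp
  also have "\<dots> \<le> r * norm ?f"
    using close by (intro mult_right_mono) auto
  also have "\<dots> < 1" by (rule r)
  finally show False by simp
qed


section \<open>The finite case\<close>

lemma l1_matrix_expansion: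
  assumes "finite (UNIV :: 'i set)"
  shows "(a :: 'i l1_matrix) = (\<Sum>i\<in>UNIV. \<Sum>j\<in>UNIV. entry a i j *\<^sub>C matrix_unit i j)"
proof (rule l1_matrix_eqI)
  fix k l
  have "entry b k l = cdual_apply (entry_functional k l) b" for b :: "'i l1_matrix"
    by (simp add: entry_functional.rep_eq)
  then have "entry (\<Sum>i\<in>UNIV. \<Sum>j\<in>UNIV. entry a i j *\<^sub>C matrix_unit i j) k l
      = (\<Sum>i\<in>UNIV. \<Sum>j\<in>UNIV. entry a i j * (if k = i \<and> l = j then 1 else 0))"
    by (simp add: cdual_apply_sum_right cdual_apply_scaleC_right)
      (simp add: entry_functional.rep_eq matrix_unit.rep_eq)
  also have "\<dots> = (\<Sum>i\<in>UNIV. if k = i then entry a k l else 0)"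
    using assms by (intro sum.cong) (auto simp: if_distrib[of "(*) _"] cong: if_cong)
  also have "\<dots> = entry a k l" using assms by simp
  finally show "entry a k l = entry (\<Sum>i\<in>UNIV. \<Sum>j\<in>UNIV. entry a i j *\<^sub>C matrix_unit i j) k l" ..
qed

text \<open>Reflexivity in finite dimension: the coordinate functionals span the dual, so
  \<open>F\<close> is determined by its values on them.\<close>

lemma bidual_l1_matrix_expansion:
  assumes "finite (UNIV :: 'i set)"
  shows "(F :: 'i l1_matrix bidual) = (\<Sum>i\<in>UNIV. \<Sum>j\<in>UNIV.
    cdual_apply (bidual_functional F) (entry_functional i j) *\<^sub>C bidual_of (matrix_unit i j))"
proof (rule bidual_eqI)
  fix f :: "'i l1_matrix cdual"
  \<comment> \<open>Dual basis expansion of \<open>f\<close>.\<close>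
  have f: "f = (\<Sum>i\<in>UNIV. \<Sum>j\<in>UNIV. cdual_apply f (matrix_unit i j) *\<^sub>C entry_functional i j)"
  proof (rule cdual_eqI)
    fix a
    show "cdual_apply f a = cdual_apply (\<Sum>i\<in>UNIV. \<Sum>j\<in>UNIV.
        cdual_apply f (matrix_unit i j) *\<^sub>C entry_functional i j) a"
      by (subst l1_matrix_expansion[OF assms])
        (simp add: cdual_apply_sum cdual_apply_sum_right cdual_apply_scaleC_right
          entry_functional.rep_eq mult.commute)
  qed
  \<comment> \<open>Viewing evaluation at \<open>f\<close> as a functional of \<open>G\<close> lets
    it pass through finite sums in \<open>bidual\<close>.\<close>
  have emb: "cdual_apply (bidual_functional G) f = cdual_apply (dual_embedding f) G" for G
    by (simp add: dual_embedding.rep_eq)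
  show "cdual_apply (bidual_functional F) f = cdual_apply (bidual_functional (\<Sum>i\<in>UNIV. \<Sum>j\<in>UNIV.
    cdual_apply (bidual_functional F) (entry_functional i j) *\<^sub>C bidual_of (matrix_unit i j))) f"
    unfolding emb cdual_apply_sum_right cdual_apply_scaleC_right
    unfolding dual_embedding.rep_eq
    by (subst f) (simp add: cdual_apply_sum_right cdual_apply_scaleC_right mult.commute)
qed

text \<open>\<open>m\<close> is the classical diagonal of a full matrix algebra: it commutes exactly
  with the algebra, and its product is the identity.\<close>

lemma strong_pseudo_amenable_finite:
  assumes fin: "finite (UNIV :: 'i set)"
  shows "strong_pseudo_amenable TYPE('i l1_matrix bidual)"
proof -
  define E :: "'i \<Rightarrow> 'i \<Rightarrow> 'i l1_matrix bidual" where "E i j = bidual_of (matrix_unit i j)" for i j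
  define n :: complex where "n = of_nat (card (UNIV :: 'i set))"
  define m where "m = inverse n *\<^sub>C (\<Sum>i\<in>UNIV. \<Sum>j\<in>UNIV. E i j \<otimes>\<^sub>p E j i)"
  \<comment> \<open>Types are non-empty, which reflects the assumption on the index set.\<close>
  have n: "n \<noteq> 0" using fin by (simp add: n_def)
  have EE: "E i j * E k l = (if j = k then E i l else 0)" for i j k l
    by (simp add: E_def matrix_unit_mult flip: bidual_of_mult)
  define c where "c a i j = cdual_apply (bidual_functional a) (entry_functional i j)"
    for a :: "'i l1_matrix bidual" and i j
  have c: "a = (\<Sum>i\<in>UNIV. \<Sum>j\<in>UNIV. c a i j *\<^sub>C E i j)" for a
    unfolding E_def c_def by (rule bidual_l1_matrix_expansion[OF fin])
  have left: "a * E i j = (\<Sum>k\<in>UNIV. c a k i *\<^sub>C E k j)" for a i j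
  proof -
    have "a * E i j = (\<Sum>k\<in>UNIV. \<Sum>l\<in>UNIV. if i = l then c a k i *\<^sub>C E k j else 0)"
      by (subst c[of a]) (auto simp: sum_distrib_right mult_scaleC_left EE intro!: sum.cong)
    then show ?thesis using fin by simp
  qed
  have right: "E j i * a = (\<Sum>l\<in>UNIV. c a i l *\<^sub>C E j l)" for a i j
  proof -
    have "E j i * a = (\<Sum>k\<in>UNIV. if i = k then \<Sum>l\<in>UNIV. c a i l *\<^sub>C E j l else 0)"
      by (subst c[of a]) (auto simp: sum_distrib_left mult_scaleC_right EE intro!: sum.cong)
    then show ?thesis using fin by simp
  qed
  have comm: "ptensor_left a m = ptensor_right m a" for a
  proof -
    \<comment> \<open>Both actions give the same triple sum up to order; the swaps below reorder
      \<open>i, j, k\<close> into \<open>k, j, i\<close>.\<close>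
    have "ptensor_left a m = inverse n *\<^sub>C (\<Sum>i\<in>UNIV. \<Sum>j\<in>UNIV. \<Sum>k\<in>UNIV. c a k i *\<^sub>C (E k j \<otimes>\<^sub>p E j i))"
      by (simp add: m_def bounded_clinear_sum[OF bounded_clinear_ptensor_left]
          bounded_clinear_scaleC[OF bounded_clinear_ptensor_left] ptensor_left_elementary_tensor left
          elementary_tensor_sum_left elementary_tensor_linear)
    also have "(\<Sum>i\<in>UNIV. \<Sum>j\<in>UNIV. \<Sum>k\<in>UNIV. c a k i *\<^sub>C (E k j \<otimes>\<^sub>p E j i))
        = (\<Sum>i\<in>UNIV. \<Sum>k\<in>UNIV. \<Sum>j\<in>UNIV. c a k i *\<^sub>C (E k j \<otimes>\<^sub>p E j i))"
      by (rule sum.cong[OF refl], rule sum.swap)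
    also have "\<dots> = (\<Sum>k\<in>UNIV. \<Sum>i\<in>UNIV. \<Sum>j\<in>UNIV. c a k i *\<^sub>C (E k j \<otimes>\<^sub>p E j i))"
      by (rule sum.swap)
    also have "\<dots> = (\<Sum>k\<in>UNIV. \<Sum>j\<in>UNIV. \<Sum>i\<in>UNIV. c a k i *\<^sub>C (E k j \<otimes>\<^sub>p E j i))"
      by (rule sum.cong[OF refl], rule sum.swap)
    also have "inverse n *\<^sub>C \<dots> = ptensor_right m a"
      by (simp add: m_def bounded_clinear_sum[OF bounded_clinear_ptensor_right]
          bounded_clinear_scaleC[OF bounded_clinear_ptensor_right] ptensor_right_elementary_tensor
          right elementary_tensor_sum_right elementary_tensor_linear)
    finally show ?thesis .
  qed
  have prod: "product_map m = (\<Sum>i\<in>UNIV. E i i)"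
  proof -
    \<comment> \<open>Every \<open>j\<close> contributes \<open>E i j * E j i = E i i\<close>. The
      explicit scalar 1 lets the sum over \<open>j\<close> collapse to the factor
      \<open>n\<close>.\<close>
    have "product_map m = inverse n *\<^sub>C (\<Sum>i\<in>UNIV. \<Sum>j\<in>(UNIV :: 'i set). 1 *\<^sub>C E i i)"
      by (simp add: m_def bounded_clinear_sum[OF bounded_clinear_product_map]
          bounded_clinear_scaleC[OF bounded_clinear_product_map] product_map_elementary_tensor EE)
    also have "\<dots> = inverse n *\<^sub>C n *\<^sub>C (\<Sum>i\<in>UNIV. E i i)"
      unfolding scaleC_sum_left[symmetric] scaleC_sum_right[symmetric]
      by (simp add: n_def)
    finally show ?thesis using n by (simp add: scaleC_scaleC)
  qed
  have unit_left: "product_map m * a = a" for a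
    unfolding prod sum_distrib_right right by (rule c[symmetric])
  have unit_right: "a * product_map m = a" for a
    unfolding prod sum_distrib_left left by (subst sum.swap) (rule c[symmetric])
  \<comment> \<open>On a one-point index set the conditions reduce, by naturality of the embedding,
    to \<open>comm\<close>, \<open>unit_left\<close> and \<open>unit_right\<close>.\<close>
  have "strong_pseudo_amenable_net {()} (\<lambda>_ _. True) (\<lambda>_. canonical_embedding m)"
    unfolding strong_pseudo_amenable_net_def Let_def
      dual_map_dual_map_canonical_embedding[OF bounded_clinear_product_map]
      bidual_left_canonical_embedding[of "(*)", OF bounded_clinear_mult_left]
      bidual_right_canonical_embedding[of "(*)", OF bounded_clinear_mult_right]
      bidual_left_canonical_embedding[of ptensor_left, OF bounded_clinear_ptensor_left]
      bidual_right_canonical_embedding[of ptensor_right, OF bounded_clinear_ptensor_right]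
    by (simp add: directed_set_def comm unit_left unit_right)
  then show ?thesis by (rule strong_pseudo_amenableI)
qed

theorem theorem3p2:
  shows "strong_pseudo_amenable TYPE('i l1_matrix bidual) \<longleftrightarrow> finite (UNIV :: 'i set)"
  using strong_pseudo_amenable_finite not_strong_pseudo_amenable by blast

end
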